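(* In the worst violated constraint model, there is an algorithm which, given oracle access to a hidden satisfiable repetition-free 2SAT instance $\Phi$ on $n$ variables, generates a satisfying assignment of $\Phi$ in time $O(n^2)$.
   Context: A SAT formula on Boolean variables $x_1,\dots,x_n$ is a conjunction of clauses $C_1,\dots,C_m$, each a disjunction of literals ($x_i$ or $\overline{x}_i$) on pairwise distinct variables; it is a 2SAT instance if each clause has at most $2$ literals. It is repetition-free if no two of its clauses are the same (i.e. no two clauses have the same set of literals). Worst violated constraint model: the formula is hidden and is accessed only through an oracle. A query is a probabilistic assignment $\mathbf{a}:[n]\to[0,1]$, meaning that independently $\Pr[x_i=1]=\mathbf{a}(i)$ and $\Pr[\overline{x}_i=1]=1-\mathbf{a}(i)$. The violation probability of a clause $C_j$ with literal set $T(C_j)$ is $\Pr[C_j=0]=\prod_{\ell\in T(C_j)}\Pr[\ell=0]$. If all clauses have violation probability $0$, the oracle reports that the formula is satisfied; otherwise it returns the index $j$ of a clause with the highest violation probability, breaking ties arbitrarily (possibly adversarially). Running time is total running time, with each oracle query costing unit time. *)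

theory Defs
  imports "HOL-Probability.Probability" "HOL-Library.Landau_Symbols"
begin

section \<open>Formulas\<close>

text \<open>The variables of a formula on \<open>n\<close> variables are \<open>0, \<dots>, n - 1\<close>. A formula is a list, so that
  its clauses have indices; clauses are identified with their sets of literals.\<close>

datatype literal = Pos nat | Neg nat

fun var :: "literal \<Rightarrow> nat" where
  "var (Pos i) = i"
| "var (Neg i) = i"

fun lit_true :: "(nat \<Rightarrow> bool) \<Rightarrow> literal \<Rightarrow> bool" where
  "lit_true v (Pos i) = v i"
| "lit_true v (Neg i) = (\<not> v i)"

type_synonym clause = "literal set"
type_synonym formula = "clause list"

definition clause_true :: "(nat \<Rightarrow> bool) \<Rightarrow> clause \<Rightarrow> bool" where
  "clause_true v C \<longleftrightarrow> (\<exists>l\<in>C. lit_true v l)"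

definition satisfies :: "(nat \<Rightarrow> bool) \<Rightarrow> formula \<Rightarrow> bool" where
  "satisfies v \<Phi> \<longleftrightarrow> (\<forall>C\<in>set \<Phi>. clause_true v C)"

definition satisfiable :: "formula \<Rightarrow> bool" where
  "satisfiable \<Phi> \<longleftrightarrow> (\<exists>v. satisfies v \<Phi>)"

definition wf_clause :: "nat \<Rightarrow> clause \<Rightarrow> bool" where
  "wf_clause n C \<longleftrightarrow> finite C \<and> inj_on var C \<and> var ` C \<subseteq> {..<n}"

definition two_sat :: "nat \<Rightarrow> formula \<Rightarrow> bool" where
  "two_sat n \<Phi> \<longleftrightarrow> (\<forall>C\<in>set \<Phi>. wf_clause n C \<and> card C \<le> 2)"

definition repetition_free :: "formula \<Rightarrow> bool" where
  "repetition_free \<Phi> \<longleftrightarrow> distinct \<Phi>"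

section \<open>The worst violated constraint oracle\<close>

definition prob_assignment :: "nat \<Rightarrow> (nat \<Rightarrow> real) \<Rightarrow> bool" where
  "prob_assignment n a \<longleftrightarrow> (\<forall>i<n. 0 \<le> a i \<and> a i \<le> 1)"

definition random_assignment :: "nat \<Rightarrow> (nat \<Rightarrow> real) \<Rightarrow> (nat \<Rightarrow> bool) pmf" where
  "random_assignment n a = Pi_pmf {..<n} False (\<lambda>i. bernoulli_pmf (a i))"

definition violation_prob :: "nat \<Rightarrow> (nat \<Rightarrow> real) \<Rightarrow> clause \<Rightarrow> real" where
  "violation_prob n a C = measure_pmf.prob (random_assignment n a) {v. \<not> clause_true v C}"

fun lit_false_prob :: "(nat \<Rightarrow> real) \<Rightarrow> literal \<Rightarrow> real" where
  "lit_false_prob a (Pos i) = 1 - a i"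
| "lit_false_prob a (Neg i) = a i"

lemma violation_prob_eq_prod:
  assumes C: "wf_clause n C" and a: "prob_assignment n a"
  shows "violation_prob n a C = (\<Prod>l\<in>C. lit_false_prob a l)"
proof -
  define B where "B = (\<lambda>i. {b. \<forall>l\<in>C. var l = i \<longrightarrow> \<not> lit_true (\<lambda>_. b) l})"
  let ?\<mu> = "\<lambda>i. measure_pmf.prob (bernoulli_pmf (a i)) (B i)"
  have loc: "lit_true v l = lit_true (\<lambda>_. v (var l)) l" for v l
    by (cases l) auto
  have vars: "var l < n" if "l \<in> C" for l
    using C that by (auto simp: wf_clause_def)
  have inj: "inj_on var C"
    using C by (auto simp: wf_clause_def)
  have set_eq: "{v. \<not> clause_true v C} = Pi {..<n} B"
  proof -
    have "\<not> clause_true v C \<longleftrightarrow> v \<in> Pi {..<n} B" for v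
    proof -
      have "\<not> clause_true v C \<longleftrightarrow> (\<forall>l\<in>C. \<not> lit_true (\<lambda>_. v (var l)) l)"
        unfolding clause_true_def using loc by blast
      also have "\<dots> \<longleftrightarrow> v \<in> Pi {..<n} B"
        using vars by (auto simp: B_def Pi_def)
      finally show ?thesis .
    qed
    then show ?thesis
      by blast
  qed
  have "violation_prob n a C = (\<Prod>i<n. ?\<mu> i)"
    by (simp add: violation_prob_def random_assignment_def set_eq measure_Pi_pmf_Pi)
  also have "\<dots> = (\<Prod>i\<in>var ` C. ?\<mu> i)"
  proof (rule prod.mono_neutral_right)
    show "var ` C \<subseteq> {..<n}"
      using vars by auto
    show "\<forall>i\<in>{..<n} - var ` C. ?\<mu> i = 1"
    proof
      fix i assume "i \<in> {..<n} - var ` C"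
      then have "B i = UNIV"
        by (auto simp: B_def)
      then show "?\<mu> i = 1"
        by simp
    qed
  qed simp
  also have "\<dots> = (\<Prod>l\<in>C. ?\<mu> (var l))"
    using inj by (simp add: prod.reindex)
  also have "\<dots> = (\<Prod>l\<in>C. lit_false_prob a l)"
  proof (rule prod.cong[OF refl])
    fix l assume l: "l \<in> C"
    have p: "0 \<le> a (var l)" "a (var l) \<le> 1"
      using a vars[OF l] by (auto simp: prob_assignment_def)
    have "B (var l) = {b. \<not> lit_true (\<lambda>_. b) l}"
      using l inj by (auto simp: B_def inj_on_def)
    also have "\<dots> = {case l of Pos _ \<Rightarrow> False | Neg _ \<Rightarrow> True}"
      by (cases l) auto
    finally show "?\<mu> (var l) = lit_false_prob a l"
      using p by (cases l) (auto simp: measure_pmf_single)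
  qed
  finally show ?thesis .
qed

text \<open>\<open>None\<close> reports that the formula is satisfied.\<close>

fun valid_answer :: "nat \<Rightarrow> formula \<Rightarrow> (nat \<Rightarrow> real) \<Rightarrow> nat option \<Rightarrow> bool" where
  "valid_answer n \<Phi> a None \<longleftrightarrow> (\<forall>C\<in>set \<Phi>. violation_prob n a C = 0)"
| "valid_answer n \<Phi> a (Some j) \<longleftrightarrow>
     \<not> (\<forall>C\<in>set \<Phi>. violation_prob n a C = 0) \<and> j < length \<Phi> \<and>
     (\<forall>C\<in>set \<Phi>. violation_prob n a C \<le> violation_prob n a (\<Phi> ! j))"

text \<open>The first argument of an oracle is the number of queries asked before. Programs being
  deterministic, this accounts for every way of breaking ties, including adversarial ones that
  depend on the whole history of the computation.\<close>

type_synonym oracle_fun = "nat \<Rightarrow> (nat \<Rightarrow> real) \<Rightarrow> nat option"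

definition worst_violated_oracle :: "nat \<Rightarrow> formula \<Rightarrow> oracle_fun \<Rightarrow> bool" where
  "worst_violated_oracle n \<Phi> orc \<longleftrightarrow>
     (\<forall>k a. prob_assignment n a \<longrightarrow> valid_answer n \<Phi> a (orc k a))"

section \<open>Algorithms: random access programs with oracle queries\<close>

text \<open>A program is a command over finitely many scalar variables and arrays of machine words. It
  is fixed independently of \<open>n\<close> and of the formula. The query to be asked is held in a separate
  array of \<open>n\<close> probabilities, which is modified one cell at a time.\<close>

type_synonym vname = string

datatype aexp =
    Num nat
  | Var vname
  | Read vname aexp
  | Plus aexp aexp
  | Minus aexp aexp
  | Times aexp aexp

datatype bexp =
    Less aexp aexp
  | Equal aexp aexp
  | BNot bexp
  | BAnd bexp bexp

datatype com =
    Skip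
  | Assign vname aexp
  | Store vname aexp aexp
  | SetProb aexp aexp aexp
  | Query vname
  | Seq com com
  | Cond bexp com com
  | While bexp com

record state =
  scalar :: "vname \<Rightarrow> nat"
  array :: "vname \<Rightarrow> nat \<Rightarrow> nat"
  probs :: "nat \<Rightarrow> real"
  queries :: nat

text \<open>Subtraction is truncated at \<open>0\<close>.\<close>

fun aval :: "aexp \<Rightarrow> state \<Rightarrow> nat" where
  "aval (Num k) s = k"
| "aval (Var x) s = scalar s x"
| "aval (Read x e) s = array s x (aval e s)"
| "aval (Plus e f) s = aval e s + aval f s"
| "aval (Minus e f) s = aval e s - aval f s"
| "aval (Times e f) s = aval e s * aval f s"

fun bval :: "bexp \<Rightarrow> state \<Rightarrow> bool" where
  "bval (Less e f) s \<longleftrightarrow> aval e s < aval f s"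
| "bval (Equal e f) s \<longleftrightarrow> aval e s = aval f s"
| "bval (BNot b) s \<longleftrightarrow> \<not> bval b s"
| "bval (BAnd b c) s \<longleftrightarrow> bval b s \<and> bval c s"

fun answer_word :: "nat option \<Rightarrow> nat" where
  "answer_word None = 0"
| "answer_word (Some j) = Suc j"

text \<open>\<open>exec n W orc c s t s'\<close>: started in state \<open>s\<close>, command \<open>c\<close> terminates in state \<open>s'\<close> after
  \<open>t\<close> time units. Every elementary command, in particular every query, and every evaluation of a
  branching condition takes one time unit. The size of an expression is fixed with the program, so
  charging for each of its operators would change the time by a constant factor only.

  There is no rule for storing a value outside \<open>{..<W}\<close>, or at an array index outside
  \<open>{..<W}\<close>, or for setting a cell of the query to anything but a probability of one of the \<open>n\<close>
  variables: such a computation is stuck and has no final state. Array cells outside \<open>{..<W}\<close>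
  thus always read as \<open>0\<close>. With \<open>W\<close> polynomial in \<open>n\<close>, words have \<open>O(log n)\<close> bits, so that
  unit-cost arithmetic on huge numbers is not available.\<close>

inductive exec :: "nat \<Rightarrow> nat \<Rightarrow> oracle_fun \<Rightarrow> com \<Rightarrow> state \<Rightarrow> nat \<Rightarrow> state \<Rightarrow> bool"
  for n :: nat and W :: nat and orc :: oracle_fun where
  Skip: "exec n W orc Skip s 1 s"
| Assign: "aval e s < W \<Longrightarrow>
    exec n W orc (Assign x e) s 1 (s\<lparr>scalar := (scalar s)(x := aval e s)\<rparr>)"
| Store: "aval e s < W \<Longrightarrow> aval f s < W \<Longrightarrow>
    exec n W orc (Store x e f) s 1
      (s\<lparr>array := (array s)(x := (array s x)(aval e s := aval f s))\<rparr>)"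
| SetProb: "aval e s < n \<Longrightarrow> aval f s \<le> aval g s \<Longrightarrow> 0 < aval g s \<Longrightarrow> aval g s < W \<Longrightarrow>
    exec n W orc (SetProb e f g) s 1
      (s\<lparr>probs := (probs s)(aval e s := real (aval f s) / real (aval g s))\<rparr>)"
| Query: "w = answer_word (orc (queries s) (probs s)) \<Longrightarrow> w < W \<Longrightarrow>
    exec n W orc (Query x) s 1
      (s\<lparr>scalar := (scalar s)(x := w), queries := Suc (queries s)\<rparr>)"
| Seq: "exec n W orc c s t s' \<Longrightarrow> exec n W orc d s' t' s'' \<Longrightarrow>
    exec n W orc (Seq c d) s (t + t') s''"
| CondTrue: "bval b s \<Longrightarrow> exec n W orc c s t s' \<Longrightarrow>
    exec n W orc (Cond b c d) s (Suc t) s'"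
| CondFalse: "\<not> bval b s \<Longrightarrow> exec n W orc d s t s' \<Longrightarrow>
    exec n W orc (Cond b c d) s (Suc t) s'"
| WhileFalse: "\<not> bval b s \<Longrightarrow> exec n W orc (While b c) s 1 s"
| WhileTrue: "bval b s \<Longrightarrow> exec n W orc c s t s' \<Longrightarrow> exec n W orc (While b c) s' t' s'' \<Longrightarrow>
    exec n W orc (While b c) s (Suc (t + t')) s''"

text \<open>The execution from a given state is unique, so that the existence of a fast and correct
  execution means that the run of the program is fast and correct.\<close>

lemma exec_deterministic:
  assumes "exec n W orc c s t s'" and "exec n W orc c s u s''"
  shows "t = u \<and> s' = s''"
  using assms
proof (induction arbitrary: u s'' rule: exec.induct)
  case (Seq c s t s' d t' s2)
  from Seq.prems show ?case
    by (cases rule: exec.cases) (use Seq.IH in blast)+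
next
  case (WhileTrue b s c t s' t' s2)
  from WhileTrue.prems show ?case
    by (cases rule: exec.cases) (use WhileTrue in blast)+
qed (erule exec.cases; force)+

text \<open>A program is given \<open>n\<close>, but not the number of clauses. Memory is initialised to \<open>0\<close>.\<close>

definition initial_state :: "nat \<Rightarrow> state" where
  "initial_state n =
     \<lparr>scalar = (\<lambda>_. 0)(''n'' := n), array = (\<lambda>_ _. 0), probs = (\<lambda>_. 0), queries = 0\<rparr>"

definition output_assignment :: "state \<Rightarrow> nat \<Rightarrow> bool" where
  "output_assignment s i \<longleftrightarrow> array s ''out'' i \<noteq> 0"

end

theory Submission
  imports Defs
begin

text \<open>The algorithm is limited backtracking for 2SAT: for an unassigned variable both values are
  propagated in lockstep, and the first propagation that is closed (every clause touching an assigned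
  variable is satisfied) is committed. A committed side with \<open>k\<close> new variables costs \<open>O(k)\<close>
  propagation steps, so there are \<open>O(n)\<close> steps altogether.

  A propagation step has to find an implied literal in \<open>O(n)\<close> time. Complete the partial assignment
  by one value \<open>b\<close> to a Boolean assignment \<open>v\<close>, and ask whether \<open>v\<close> or some \<open>v\<close> with one free
  variable flipped satisfies the formula; if so, we are done. Otherwise query a perturbation of \<open>v\<close>
  whose probabilities make all violation probabilities of violated clauses distinct, and larger for
  clauses touching assigned variables. The free variables of the worst clause are then those for
  which a query that nearly flips the variable is answered differently: the flipped assignment
  violates some other clause. No free variable means a conflict, one means an implied literal, and two
  mean that no clause violated by \<open>v\<close> touches an assigned variable. If the latter happens for both
  values of \<open>b\<close>, the partial assignment is closed.\<close>

section \<open>Formulas and partial assignments\<close>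

text \<open>The oracle reveals an index, never a literal, so a clause is recognised only by
  comparing answers. Without repetitions equal indices mean equal clauses, and distinct violation
  probabilities leave an adversary no tie to break. Variables are all that has to be found: in a
  clause violated by a known \<open>v\<close> every sign is forced by the variable. The preliminary
  flip queries make the variable test sound. If the flipped assignment satisfied the formula, no
  other clause need overtake the worst one when a variable of it is moved, and its index could come
  back unchanged. Words have O(log n) bits, which excludes weights such as distinct powers of two.
  Nearly equal weights \<open>K + m i\<close> with \<open>K\<close> quadratic in \<open>n\<close>
  already separate products of two factors, and clauses have at most two literals. Two completions
  are needed because a clause made of a false assigned literal and a free literal is violated by
  exactly one of them. Lockstep is needed because a side may grow long before it dies or is
  abandoned; run in parallel, it costs no more than the side that is committed.\<close>

lemma clause_true_cong:
  assumes "wf_clause n C" "\<And>i. i < n \<Longrightarrow> v i = w i"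
  shows "clause_true v C = clause_true w C"
proof -
  have "lit_true v l = lit_true w l" if "l \<in> C" for l
  proof -
    have "var l < n" using that assms(1) by (auto simp: wf_clause_def)
    then show ?thesis using assms(2) by (cases l) auto
  qed
  then show ?thesis by (auto simp: clause_true_def)
qed

lemma wf_clause_small_cases:
  assumes "wf_clause n C" "card C \<le> 2" "C \<noteq> {}"
  obtains (unit) l where "C = {l}" "var l < n"
  | (pair) l l' where "C = {l, l'}" "l \<noteq> l'" "var l \<noteq> var l'" "var l < n" "var l' < n"
proof -
  have fin: "finite C" and inj: "inj_on var C" and vars: "var ` C \<subseteq> {..<n}"
    using assms(1) by (auto simp: wf_clause_def)
  have "card C \<noteq> 0" using fin assms(3) by simp
  then consider "card C = 1" | "card C = 2" using assms(2) by linarith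
  then show ?thesis
  proof cases
    case 1
    then obtain l where "C = {l}" by (auto simp: card_Suc_eq numeral_eq_Suc)
    then show ?thesis using unit vars by auto
  next
    case 2
    then obtain l l' where C: "C = {l, l'}" "l \<noteq> l'" by (auto simp: card_2_iff)
    then have "var l \<noteq> var l'" using inj by (auto simp: inj_on_def)
    then show ?thesis using pair C vars by auto
  qed
qed

lemma lit_true_iff_of_var:
  "lit_true v l \<longleftrightarrow> (case l of Pos _ \<Rightarrow> v (var l) | Neg _ \<Rightarrow> \<not> v (var l))"
  by (cases l) auto

text \<open>Falsity under a fixed assignment forces the sign. Hence a violated clause is determined
  by its set of variables, which is all that a symmetric weighting of the variables can
  reveal.\<close>

lemma false_lits_eq:
  assumes "\<not> lit_true v l" "\<not> lit_true v l'" "var l = var l'"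
  shows "l = l'"
  using assms by (cases l; cases l') auto

text \<open>Partial assignments are coded by \<open>0\<close> (free), \<open>1\<close> (false) and \<open>2\<close> (true).\<close>

definition extends :: "nat \<Rightarrow> (nat \<Rightarrow> bool) \<Rightarrow> (nat \<Rightarrow> nat) \<Rightarrow> bool" where
  "extends n w A \<longleftrightarrow> (\<forall>i<n. A i \<noteq> 0 \<longrightarrow> w i = (A i \<noteq> 1))"

text \<open>Numbers rather than Booleans, since this is the word that the program writes to
  \<open>out\<close> and uses as a probability. Subtracting 1 turns the codes 1 and 2 into 0 and 1;
  \<open>filled\<close> is the Boolean reading.\<close>

definition fill :: "(nat \<Rightarrow> nat) \<Rightarrow> nat \<Rightarrow> nat \<Rightarrow> nat" where
  "fill A b i = (if A i = 0 then b else A i - 1)"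

definition filled :: "(nat \<Rightarrow> nat) \<Rightarrow> nat \<Rightarrow> nat \<Rightarrow> bool" where
  "filled A b i \<longleftrightarrow> fill A b i \<noteq> 0"

text \<open>In SAT terminology, \<open>A\<close> is an autarky of the formula.\<close>

definition closed_under :: "formula \<Rightarrow> (nat \<Rightarrow> nat) \<Rightarrow> bool" where
  "closed_under \<Phi> A \<longleftrightarrow> (\<forall>C\<in>set \<Phi>. (\<exists>l\<in>C. A (var l) \<noteq> 0) \<longrightarrow>
     (\<exists>l\<in>C. A (var l) \<noteq> 0 \<and> lit_true (\<lambda>i. A i \<noteq> 1) l))"

definition free_count :: "nat \<Rightarrow> (nat \<Rightarrow> nat) \<Rightarrow> nat" where
  "free_count n A = card {i. i < n \<and> A i = 0}"

lemma free_count_upd: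
  assumes "t < n" "A t = 0" "c \<noteq> 0"
  shows "Suc (free_count n (A(t := c))) = free_count n A"
proof -
  have "{i. i < n \<and> A i = 0} = insert t {i. i < n \<and> (A(t := c)) i = 0}"
    using assms by auto
  then show ?thesis using assms by (simp add: free_count_def)
qed

text \<open>Overwrite any satisfying assignment by \<open>A\<close>: clauses that \<open>A\<close>
  touches are satisfied by \<open>A\<close> itself, and the others do not notice the change. This is
  why a committed choice never has to be undone.\<close>

lemma closed_under_extendable:
  assumes "closed_under \<Phi> A" "satisfiable \<Phi>"
  shows "\<exists>w. satisfies w \<Phi> \<and> extends n w A"
proof -
  obtain u where u: "satisfies u \<Phi>" using assms(2) by (auto simp: satisfiable_def)
  define w where "w i = (if A i \<noteq> 0 then A i \<noteq> 1 else u i)" for i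
  have "clause_true w C" if C: "C \<in> set \<Phi>" for C
  proof (cases "\<exists>l\<in>C. A (var l) \<noteq> 0")
    case True
    then obtain l where "l \<in> C" "A (var l) \<noteq> 0" "lit_true (\<lambda>i. A i \<noteq> 1) l"
      using assms(1) C by (auto simp: closed_under_def)
    then show ?thesis
      by (auto simp: clause_true_def w_def lit_true_iff_of_var split: literal.splits intro!: bexI[of _ l])
  next
    case False
    obtain l where "l \<in> C" "lit_true u l" using u C by (auto simp: satisfies_def clause_true_def)
    then show ?thesis using False
      by (auto simp: clause_true_def w_def lit_true_iff_of_var split: literal.splits intro!: bexI[of _ l])
  qed
  then show ?thesis by (intro exI[of _ w]) (auto simp: satisfies_def extends_def w_def)
qed

text \<open>Suppose a clause touches \<open>A\<close> but has no true assigned literal. Its assigned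
  literals are false in both completions, and a remaining free literal is false in one of them, so
  that completion violates a clause touching an assigned variable.\<close>

lemma closed_under_if_completions:
  assumes "two_sat n \<Phi>" "\<And>i. A i \<le> 2"
    and "\<And>b C l. b \<in> {0, 1} \<Longrightarrow> C \<in> set \<Phi> \<Longrightarrow> \<not> clause_true (filled A b) C \<Longrightarrow> l \<in> C \<Longrightarrow> A (var l) = 0"
  shows "closed_under \<Phi> A"
  unfolding closed_under_def
proof (intro ballI impI)
  fix C assume C: "C \<in> set \<Phi>" and "\<exists>l\<in>C. A (var l) \<noteq> 0"
  then obtain f where f: "f \<in> C" "A (var f) \<noteq> 0" by blast
  have wf: "wf_clause n C" "card C \<le> 2" using C assms(1) by (auto simp: two_sat_def)
  have fixed: "lit_true (filled A b) l = lit_true (\<lambda>i. A i \<noteq> 1) l" if "A (var l) \<noteq> 0" for b l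
    using that assms(2)[of "var l"]
    by (auto simp: filled_def fill_def lit_true_iff_of_var split: literal.splits)
  show "\<exists>l\<in>C. A (var l) \<noteq> 0 \<and> lit_true (\<lambda>i. A i \<noteq> 1) l"
  proof (rule ccontr)
    assume none: "\<not> ?thesis"
    have "\<exists>b\<in>{0, 1}. \<not> clause_true (filled A b) C"
    proof -
      have "C \<noteq> {}" using f by blast
      with wf have "\<exists>p q. C = {p, q}" by (cases rule: wf_clause_small_cases) (metis insert_absorb2)+
      then obtain g where g: "C = {f, g}" using f(1) by (metis insert_commute insertE singletonD)
      show ?thesis
      proof (cases "A (var g) = 0")
        case True
        \<comment> \<open>The completion value that makes the free literal \<open>g\<close>
          false.\<close>
        define b :: nat where "b = (case g of Pos _ \<Rightarrow> 0 | Neg _ \<Rightarrow> 1)"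
        have "\<not> lit_true (filled A b) g"
          using True by (cases g) (auto simp: filled_def fill_def b_def)
        moreover have "\<not> lit_true (filled A b) f" using f none fixed by blast
        moreover have "b \<in> {0, 1}" by (auto simp: b_def split: literal.splits)
        ultimately show ?thesis using g by (auto simp: clause_true_def)
      next
        \<comment> \<open>This case includes unit clauses, where \<open>g = f\<close>. All literals
          are assigned and false, so either completion will do.\<close>
        case False
        then have "\<not> clause_true (filled A 0) C"
          using g none f fixed by (auto simp: clause_true_def)
        then show ?thesis by blast
      qed
    qed
    then obtain b :: nat where "b \<in> {0, 1}" "\<not> clause_true (filled A b) C" by blast
    then show False using assms(3)[OF _ C _ f(1)] f(2) by simp
  qed
qed

lemma satisfies_if_closed_total:
  assumes "closed_under \<Phi> A" "satisfiable \<Phi>" "two_sat n \<Phi>" "\<And>i. i < n \<Longrightarrow> A i \<noteq> 0"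
  shows "satisfies (\<lambda>i. A i \<noteq> 1) \<Phi>"
proof -
  have "clause_true (\<lambda>i. A i \<noteq> 1) C" if C: "C \<in> set \<Phi>" for C
  proof -
    obtain l where l: "l \<in> C" using C assms(2) by (auto simp: satisfiable_def satisfies_def clause_true_def)
    then have "var l < n" using C assms(3) by (auto simp: two_sat_def wf_clause_def)
    then show ?thesis using C l assms(1,4) unfolding closed_under_def clause_true_def by blast
  qed
  then show ?thesis by (auto simp: satisfies_def)
qed

section \<open>Identifying the free variables of the worst violated clause\<close>

text \<open>The violation probability as a bare product; once the two are identified, no probability
  theory is needed.\<close>

definition viol :: "(nat \<Rightarrow> real) \<Rightarrow> clause \<Rightarrow> real" where
  "viol a C = (\<Prod>l\<in>C. lit_false_prob a l)"

lemma lit_false_prob_cong: "a (var l) = a' (var l) \<Longrightarrow> lit_false_prob a l = lit_false_prob a' l"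
  by (cases l) auto

lemma viol_cong:
  assumes "\<And>l. l \<in> C \<Longrightarrow> a (var l) = a' (var l)"
  shows "viol a C = viol a' C"
  unfolding viol_def using assms by (intro prod.cong) (auto intro: lit_false_prob_cong)

lemma viol_zero_one:
  assumes "wf_clause n C" "\<And>i. i < n \<Longrightarrow> a i = of_bool (v i)"
  shows "viol a C = of_bool (\<not> clause_true v C)"
proof -
  have "lit_false_prob a l = of_bool (\<not> lit_true v l)" if "l \<in> C" for l
  proof -
    have "var l < n" using that assms(1) by (auto simp: wf_clause_def)
    then show ?thesis using assms(2) by (cases l) auto
  qed
  then have "viol a C = (\<Prod>l\<in>C. of_bool (\<not> lit_true v l))" by (auto simp: viol_def)
  also have "\<dots> = of_bool (\<not> clause_true v C)"
    using assms(1) by (auto simp: clause_true_def wf_clause_def)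
  finally show ?thesis .
qed

text \<open>For \<open>K\<close> large the order of the products \<open>(K + x) (K + y)\<close> is the lexicographic order of
  \<open>(x + y, x y)\<close>, so the product determines \<open>{x, y}\<close>.\<close>

lemma shifted_product_less:
  fixes K x y x' y' :: nat
  assumes "x * y < K" "x + y < x' + y'"
  shows "(K + x) * (K + y) < (K + x') * (K + y')"
proof -
  have "(K + x) * (K + y) = K * K + K * (x + y) + x * y" by (simp add: algebra_simps)
  also have "\<dots> < K * K + K * Suc (x + y)" using assms(1) by simp
  also have "\<dots> \<le> K * K + K * (x' + y')" using assms(2) by (intro add_left_mono mult_left_mono) auto
  also have "\<dots> \<le> (K + x') * (K + y')" by (simp add: algebra_simps)
  finally show ?thesis .
qed

lemma shifted_product_eq:
  fixes K x y x' y' :: nat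
  assumes "x * y < K" "x' * y' < K" "(K + x) * (K + y) = (K + x') * (K + y')"
  shows "{x, y} = {x', y'}"
proof -
  have s: "x + y = x' + y'"
    using shifted_product_less[of x y K x' y'] shifted_product_less[of x' y' K x y] assms by linarith
  have "x * y + K * (x + y) = x' * y' + K * (x' + y')" using assms(3) by (simp add: algebra_simps)
  then have p: "x * y = x' * y'" using s by simp
  \<comment> \<open>Pairs with equal sum and equal product are the roots of the same quadratic.
    Eliminating \<open>y'\<close> makes the difference of the products factor; the integers avoid
    truncated subtraction.\<close>
  have y': "int y' = int x + int y - int x'" using s by linarith
  have "int x * int y = int x' * int y'" using p by (metis of_nat_mult)
  then have "(int x - int x') * (int x' - int y) = 0"
    unfolding y' by (simp add: algebra_simps)
  then have "x = x' \<or> x' = y" by auto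
  then show ?thesis using s by auto
qed

section \<open>What answers of the oracle reveal about the hidden formula\<close>

locale hidden_2sat =
  fixes n :: nat and \<Phi> :: formula and orc :: oracle_fun
  assumes two_sat_formula: "two_sat n \<Phi>" and rep_free: "repetition_free \<Phi>" and sat: "satisfiable \<Phi>"
    and orc_valid: "worst_violated_oracle n \<Phi> orc"
begin

lemma wf: "C \<in> set \<Phi> \<Longrightarrow> wf_clause n C"
  and card_le: "C \<in> set \<Phi> \<Longrightarrow> card C \<le> 2"
  using two_sat_formula by (auto simp: two_sat_def)

lemma nonempty: "C \<in> set \<Phi> \<Longrightarrow> C \<noteq> {}"
  using sat by (auto simp: satisfiable_def satisfies_def clause_true_def)

lemma clause_cases:
  assumes "C \<in> set \<Phi>"
  obtains (unit) l where "C = {l}" "var l < n"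
  | (pair) l l' where "C = {l, l'}" "l \<noteq> l'" "var l \<noteq> var l'" "var l < n" "var l' < n"
proof -
  show thesis
    by (rule wf_clause_small_cases[OF wf[OF assms] card_le[OF assms] nonempty[OF assms]])
      (rule that(1), assumption+, rule that(2), assumption+)
qed

lemma satisfies_cong:
  assumes "\<And>i. i < n \<Longrightarrow> v i = w i"
  shows "satisfies v \<Phi> = satisfies w \<Phi>"
proof -
  have "clause_true v C = clause_true w C" if "C \<in> set \<Phi>" for C
    by (rule clause_true_cong[OF wf[OF that]]) (rule assms)
  then show ?thesis by (simp add: satisfies_def)
qed

lemma violation_prob_eq_viol:
  "C \<in> set \<Phi> \<Longrightarrow> prob_assignment n a \<Longrightarrow> violation_prob n a C = viol a C"
  using violation_prob_eq_prod[OF wf] by (simp add: viol_def)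

lemma answer_cases:
  assumes a: "prob_assignment n a"
  obtains (none) "orc k a = None" "\<And>C. C \<in> set \<Phi> \<Longrightarrow> viol a C = 0"
  | (some) j where "orc k a = Some j" "j < length \<Phi>" "\<And>C. C \<in> set \<Phi> \<Longrightarrow> viol a C \<le> viol a (\<Phi> ! j)"
      "\<exists>C\<in>set \<Phi>. viol a C \<noteq> 0"
proof -
  have ans: "valid_answer n \<Phi> a (orc k a)" using orc_valid a by (simp add: worst_violated_oracle_def)
  show thesis
  proof (cases "orc k a")
    case None
    have "viol a C = 0" if "C \<in> set \<Phi>" for C
      using ans that violation_prob_eq_viol[OF that a] unfolding None by simp
    then show thesis using that(1) None by blast
  next
    case (Some j)
    then have j: "j < length \<Phi>" using ans by simp
    then have "\<Phi> ! j \<in> set \<Phi>" by simp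
    then have "viol a C \<le> viol a (\<Phi> ! j)" if "C \<in> set \<Phi>" for C
      using ans that violation_prob_eq_viol[OF _ a] unfolding Some by simp
    moreover have "\<exists>C\<in>set \<Phi>. viol a C \<noteq> 0"
      using ans violation_prob_eq_viol[OF _ a] unfolding Some by auto
    ultimately show thesis using that(2)[OF Some j] by blast
  qed
qed

text \<open>At a 0/1 assignment every violation probability is 0 or 1, so a single query decides
  whether a given assignment satisfies the formula.\<close>

lemma answer_word_eq_0_iff:
  assumes "\<And>i. i < n \<Longrightarrow> a i = of_bool (v i)"
  shows "answer_word (orc k a) = 0 \<longleftrightarrow> satisfies v \<Phi>"
proof -
  have a: "prob_assignment n a" using assms by (auto simp: prob_assignment_def)
  have "viol a C = of_bool (\<not> clause_true v C)" if "C \<in> set \<Phi>" for C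
    using viol_zero_one[OF wf[OF that] assms] .
  then have "satisfies v \<Phi> \<longleftrightarrow> (\<forall>C\<in>set \<Phi>. viol a C = 0)" by (simp add: satisfies_def)
  with a show ?thesis by (cases rule: answer_cases[where k = k]) simp_all
qed

text \<open>Satisfiability excludes the empty clause, so every clause is \<open>{p, q}\<close> for
  two of the \<open>2 * n\<close> literals, with \<open>p = q\<close> for unit clauses; absence of
  repetitions turns this into a bound on indices. It ensures that answers fit into a word.\<close>

lemma length_le: "length \<Phi> \<le> 4 * n * n + 1"
proof -
  let ?L = "Pos ` {..<n} \<union> Neg ` {..<n}"
  have L: "l \<in> ?L" if "var l < n" for l using that by (cases l) auto
  have "set \<Phi> \<subseteq> (\<lambda>(p, q). {p, q}) ` (?L \<times> ?L)"
  proof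
    fix C assume "C \<in> set \<Phi>"
    then have "\<exists>p q. C = {p, q} \<and> var p < n \<and> var q < n"
      by (cases rule: clause_cases) (metis insert_absorb2)+
    then obtain p q where "C = {p, q}" "var p < n" "var q < n" by blast
    then show "C \<in> (\<lambda>(p, q). {p, q}) ` (?L \<times> ?L)"
      using L[of p] L[of q] by (intro image_eqI[of _ _ "(p, q)"]) (simp, blast)
  qed
  then have "card (set \<Phi>) \<le> card (?L \<times> ?L)"
    by (rule surj_card_le[rotated]) auto
  also have "\<dots> \<le> (2 * n) * (2 * n)"
  proof -
    have "card ?L \<le> card (Pos ` {..<n}) + card (Neg ` {..<n})" by (rule card_Un_le)
    also have "\<dots> \<le> n + n" by (intro add_mono) (metis card_image_le card_lessThan finite_lessThan)+
    finally show ?thesis unfolding card_cartesian_product by (intro mult_mono) auto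
  qed
  finally show ?thesis using rep_free by (simp add: repetition_free_def distinct_card)
qed

lemma answer_word_le:
  assumes "prob_assignment n a"
  shows "answer_word (orc k a) \<le> 4 * n * n + 1"
  by (rule answer_cases[OF assms, of k]) (use length_le in simp_all)

end

text \<open>A weighted version of a Boolean assignment \<open>v\<close>: every literal that is false under \<open>v\<close> is
  false with probability \<open>(K + m i) / (K + M)\<close>, close to \<open>1\<close>.\<close>

locale weighted_query = hidden_2sat +
  fixes v :: "nat \<Rightarrow> bool" and m :: "nat \<Rightarrow> nat" and K M :: nat and a :: "nat \<Rightarrow> real"
  assumes m_inj: "inj_on m {..<n}" and m_less: "\<And>i. i < n \<Longrightarrow> m i < M"
    and K_M: "M * M < K" and K9: "9 * M \<le> K"
    and a_eq: "\<And>i. i < n \<Longrightarrow> a i = (if v i then real (K + m i) else real (M - m i)) / real (K + M)"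
    and unsat: "\<not> satisfies v \<Phi>"
begin

lemma K_pos: "K > 0" using K_M by simp

lemma pf_false:
  assumes "var l < n" "\<not> lit_true v l"
  shows "lit_false_prob a l = real (K + m (var l)) / real (K + M)"
proof -
  have "1 - real (M - m i) / real (K + M) = real (K + m i) / real (K + M)" if "i < n" for i
    using m_less[OF that] K_pos by (simp add: field_simps of_nat_diff)
  then show ?thesis using assms by (cases l) (auto simp: a_eq)
qed

lemma pf_true:
  assumes "var l < n" "lit_true v l"
  shows "lit_false_prob a l = real (M - m (var l)) / real (K + M)"
proof -
  have "1 - real (K + m i) / real (K + M) = real (M - m i) / real (K + M)" if "i < n" for i
    using m_less[OF that] K_pos by (simp add: field_simps of_nat_diff)
  then show ?thesis using assms by (cases l) (auto simp: a_eq)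
qed

lemma a_bounds: "i < n \<Longrightarrow> 0 \<le> a i \<and> a i \<le> 1"
  using m_less[of i] K_pos by (auto simp: a_eq field_simps)

lemma prob_a: "prob_assignment n a"
  using a_bounds by (simp add: prob_assignment_def)

lemma pf_bounds: "var l < n \<Longrightarrow> 0 \<le> lit_false_prob a l \<and> lit_false_prob a l \<le> 1"
  using a_bounds[of "var l"] by (cases l) auto

text \<open>The bound 9/10 for \<open>K / (K + M)\<close> is the assumption
  \<open>9 * M \<le> K\<close> rewritten. The other size assumption, \<open>M * M < K\<close>,
  serves the decoding of products.\<close>

lemma pf_false_ge:
  assumes "var l < n" "\<not> lit_true v l"
  shows "9/10 \<le> lit_false_prob a l"
proof -
  have "9 * real M \<le> real K" using K9 by (metis of_nat_le_iff of_nat_mult of_nat_numeral)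
  then have "9 * (real K + real M) \<le> 10 * (real K + real (m (var l)))" by simp
  then show ?thesis using K_pos by (simp add: pf_false[OF assms] field_simps)
qed

lemma pf_true_le:
  assumes "var l < n" "lit_true v l"
  shows "lit_false_prob a l \<le> 1/10"
proof -
  have "9 * real M \<le> real K" using K9 by (metis of_nat_le_iff of_nat_mult of_nat_numeral)
  moreover have "real (M - m (var l)) \<le> real M" by simp
  ultimately have "10 * real (M - m (var l)) \<le> real K + real M" by linarith
  then show ?thesis using K_pos by (simp add: pf_true[OF assms] field_simps)
qed

lemma viol_satisfied_le:
  assumes C: "C \<in> set \<Phi>" and "clause_true v C"
  shows "viol a C \<le> 1/10"
  using C
proof (cases rule: clause_cases)
  case (unit l)
  then show ?thesis using assms(2) pf_true_le[of l] by (auto simp: viol_def clause_true_def)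
next
  case (pair l l')
  then consider "lit_true v l" | "lit_true v l'" using assms(2) by (auto simp: clause_true_def)
  then show ?thesis
  proof cases
    case 1
    have "lit_false_prob a l * lit_false_prob a l' \<le> 1/10 * 1"
      using pair 1 pf_true_le[of l] pf_bounds[of l] pf_bounds[of l'] by (intro mult_mono) auto
    then show ?thesis using pair by (simp add: viol_def)
  next
    case 2
    have "lit_false_prob a l * lit_false_prob a l' \<le> 1 * (1/10)"
      using pair 2 pf_true_le[of l'] pf_bounds[of l] pf_bounds[of l'] by (intro mult_mono) auto
    then show ?thesis using pair by (simp add: viol_def)
  qed
qed

text \<open>The bound is the square of 9/10. It has to exceed both the 1/10 that bounds satisfied
  clauses and the 3/4 of the later flip test.\<close>

lemma viol_violated_ge:
  assumes C: "C \<in> set \<Phi>" and "\<not> clause_true v C"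
  shows "81/100 \<le> viol a C"
  using C
proof (cases rule: clause_cases)
  case (unit l)
  then show ?thesis using assms(2) pf_false_ge[of l] by (auto simp: viol_def clause_true_def)
next
  case (pair l l')
  have "9/10 * (9/10) \<le> lit_false_prob a l * lit_false_prob a l'"
    using pair assms(2) pf_false_ge[of l] pf_false_ge[of l'] by (intro mult_mono) (auto simp: clause_true_def)
  then show ?thesis using pair by (simp add: viol_def)
qed

text \<open>A unit clause behaves like a pair whose second literal is false with probability
  \<open>(K + M) / (K + M) = 1\<close>.\<close>

lemma viol_violated_eq:
  assumes C: "C \<in> set \<Phi>" and "\<not> clause_true v C"
  obtains x y where "viol a C = real ((K + x) * (K + y)) / real ((K + M) * (K + M))"
    "x * y < K" "x \<noteq> y" "{x, y} - {M} = m ` var ` C"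
  using C
proof (cases rule: clause_cases)
  case (unit l)
  have "m (var l) * M \<le> M * M" using m_less[OF unit(2)] by (intro mult_right_mono) auto
  then have "m (var l) * M < K" using K_M by linarith
  moreover have "viol a C = real ((K + m (var l)) * (K + M)) / real ((K + M) * (K + M))"
    using unit assms(2) K_pos by (simp add: viol_def clause_true_def pf_false)
  ultimately show ?thesis using that[of "m (var l)" M] unit m_less[OF unit(2)] by auto
next
  case (pair l l')
  have "m (var l) * m (var l') \<le> M * M"
    using m_less[OF pair(4)] m_less[OF pair(5)] by (intro mult_mono) auto
  then have "m (var l) * m (var l') < K" using K_M by linarith
  moreover have "viol a C = real ((K + m (var l)) * (K + m (var l'))) / real ((K + M) * (K + M))"
    using pair assms(2) by (simp add: viol_def clause_true_def pf_false)
  moreover have "m (var l) \<noteq> m (var l')" using pair m_inj by (auto simp: inj_on_def)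
  ultimately show ?thesis
    using that[of "m (var l)" "m (var l')"] pair m_less[OF pair(4)] m_less[OF pair(5)] by auto
qed

text \<open>The probability determines the unordered pair of summands; deleting the filler
  \<open>M\<close> leaves the weights of the variables, injectivity of \<open>m\<close> gives the
  variables, and violation by \<open>v\<close> gives the signs.\<close>

lemma viol_eq_imp_eq:
  assumes C: "C \<in> set \<Phi>" "\<not> clause_true v C" and C': "C' \<in> set \<Phi>" "\<not> clause_true v C'"
    and eq: "viol a C = viol a C'"
  shows "C = C'"
proof -
  obtain x y where 1: "viol a C = real ((K + x) * (K + y)) / real ((K + M) * (K + M))"
    "x * y < K" "{x, y} - {M} = m ` var ` C"
    using viol_violated_eq[OF C] by metis
  obtain x' y' where 2: "viol a C' = real ((K + x') * (K + y')) / real ((K + M) * (K + M))"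
    "x' * y' < K" "{x', y'} - {M} = m ` var ` C'"
    using viol_violated_eq[OF C'] by metis
  have "real ((K + x) * (K + y)) = real ((K + x') * (K + y'))"
    using eq K_pos unfolding 1(1) 2(1) by (simp add: divide_cancel_right)
  then have "(K + x) * (K + y) = (K + x') * (K + y')" by (simp only: of_nat_eq_iff)
  then have "{x, y} = {x', y'}" by (rule shifted_product_eq[OF 1(2) 2(2)])
  then have meq: "m ` var ` C = m ` var ` C'" unfolding 1(3)[symmetric] 2(3)[symmetric] by (rule arg_cong)
  have sub: "var ` C \<subseteq> {..<n}" "var ` C' \<subseteq> {..<n}"
    using wf[OF C(1)] wf[OF C'(1)] by (simp_all add: wf_clause_def)
  have vars: "var ` C = var ` C'" by (rule inj_on_image_eq_iff[OF m_inj sub, THEN iffD1, OF meq])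
  have incl: "D \<subseteq> D'" if "var ` D = var ` D'" "\<not> clause_true v D" "\<not> clause_true v D'" for D D'
  proof
    fix l assume l: "l \<in> D"
    then have "var l \<in> var ` D'" using that(1) by blast
    then obtain l' where l': "l' \<in> D'" "var l = var l'" by blast
    then have "l = l'" using false_lits_eq[of v l l'] that l by (auto simp: clause_true_def)
    then show "l \<in> D'" using l' by simp
  qed
  show ?thesis using incl[OF vars C(2) C'(2)] incl[OF vars[symmetric] C'(2) C(2)] by (rule equalityI)
qed

text \<open>The strict inequality is the point: the worst clause is unique, so tie breaking has no
  influence on which index is returned.\<close>

lemma worst_clause:
  obtains j where "orc k a = Some j" "j < length \<Phi>" "\<not> clause_true v (\<Phi> ! j)"
    "\<And>C. C \<in> set \<Phi> \<Longrightarrow> C \<noteq> \<Phi> ! j \<Longrightarrow> viol a C < viol a (\<Phi> ! j)"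
proof -
  obtain C0 where C0: "C0 \<in> set \<Phi>" "\<not> clause_true v C0" using unsat by (auto simp: satisfies_def)
  then have big: "81/100 \<le> viol a C0" using viol_violated_ge by blast
  show thesis
  proof (rule answer_cases[OF prob_a, of k])
    assume "\<And>C. C \<in> set \<Phi> \<Longrightarrow> viol a C = 0"
    then show thesis using big C0 by fastforce
  next
    fix j assume some: "orc k a = Some j" "j < length \<Phi>" "\<And>C. C \<in> set \<Phi> \<Longrightarrow> viol a C \<le> viol a (\<Phi> ! j)"
    have j: "\<Phi> ! j \<in> set \<Phi>" using some by simp
    have "81/100 \<le> viol a (\<Phi> ! j)" using some(3)[OF C0(1)] big by linarith
    then have viol_j: "\<not> clause_true v (\<Phi> ! j)" using viol_satisfied_le[OF j] by fastforce
    have "viol a C < viol a (\<Phi> ! j)" if "C \<in> set \<Phi>" "C \<noteq> \<Phi> ! j" for C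
    proof (cases "clause_true v C")
      case True
      then show ?thesis using viol_satisfied_le[OF that(1)] viol_violated_ge[OF j viol_j] by linarith
    next
      case False
      have "viol a C \<noteq> viol a (\<Phi> ! j)" using viol_eq_imp_eq[OF that(1) False j viol_j] that(2) by blast
      then show ?thesis using some(3)[OF that(1)] by simp
    qed
    then show thesis using that some(1,2) viol_j by blast
  qed
qed

text \<open>If \<open>i\<close> occurs in the worst clause, moving \<open>x\<^sub>i\<close> most of the way to its opposite value satisfies
  that clause with high probability, but some clause is violated by the flipped assignment and takes
  over. Otherwise the clause stays the worst one, since the newly violated clauses have violation
  probability at most \<open>3/4\<close>.\<close>

lemma flip_test:
  assumes j: "orc k a = Some j" and i: "i < n" and flip: "\<not> satisfies (v(i := \<not> v i)) \<Phi>"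
    and a': "\<And>k. k < n \<Longrightarrow> a' k = (if k = i then (if v i then 1/4 else 3/4) else a k)"
  shows "prob_assignment n a'" "orc k' a' = Some j \<longleftrightarrow> i \<notin> var ` (\<Phi> ! j)"
proof -
  have *: "0 \<le> a' k \<and> a' k \<le> 1" if "k < n" for k
    using a'[OF that] a_bounds[OF that] by (cases "k = i") auto
  then show prob: "prob_assignment n a'" by (simp add: prob_assignment_def)
  have pf'_bounds: "0 \<le> lit_false_prob a' l \<and> lit_false_prob a' l \<le> 1" if "var l < n" for l
    using *[OF that] by (cases l) auto
  have pf'_other: "lit_false_prob a' l = lit_false_prob a l" if "var l < n" "var l \<noteq> i" for l
    by (rule lit_false_prob_cong) (use a'[OF that(1)] that(2) in simp)
  \<comment> \<open>Two constraints fix the choice of 3/4: it is below 81/100, so that newly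
    violated clauses cannot overtake a worst clause without \<open>i\<close>, and its square 9/16 is
    above 1/4, so that they do overtake one containing \<open>i\<close>.\<close>
  have pf'_i: "lit_false_prob a' l = (if lit_true v l then 3/4 else 1/4)" if "var l = i" for l
    using a'[OF i] that by (cases l) auto
  have viol'_other: "viol a' C = viol a C" if "C \<in> set \<Phi>" "i \<notin> var ` C" for C
  proof (rule viol_cong)
    fix l assume l: "l \<in> C"
    then have "var l < n" using wf[OF that(1)] by (auto simp: wf_clause_def)
    moreover have "var l \<noteq> i" using l that(2) by blast
    ultimately show "a' (var l) = a (var l)" using a' by simp
  qed
  have viol'_le: "viol a' C \<le> lit_false_prob a' l" if C: "C \<in> set \<Phi>" and l: "l \<in> C" for C l
    using C
  proof (cases rule: clause_cases)
    case (unit p)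
    then show ?thesis using l by (simp add: viol_def)
  next
    case (pair p q)
    have "lit_false_prob a' p * lit_false_prob a' q \<le> lit_false_prob a' p"
      "lit_false_prob a' p * lit_false_prob a' q \<le> lit_false_prob a' q"
      using pf'_bounds pair by (auto intro: mult_left_le mult_left_le_one_le)
    then show ?thesis using l pair by (auto simp: viol_def)
  qed
  obtain j' where "orc k a = Some j'" and worst: "j' < length \<Phi>" "\<not> clause_true v (\<Phi> ! j')"
    "\<And>C. C \<in> set \<Phi> \<Longrightarrow> C \<noteq> \<Phi> ! j' \<Longrightarrow> viol a C < viol a (\<Phi> ! j')"
    by (rule worst_clause[of k]) blast
  then have "j' = j" using j by simp
  note worst = worst[unfolded this]
  let ?C = "\<Phi> ! j"
  have C: "?C \<in> set \<Phi>" using worst(1) by simp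
  show "orc k' a' = Some j \<longleftrightarrow> i \<notin> var ` (\<Phi> ! j)"
  proof
    assume notin: "i \<notin> var ` ?C"
    have less: "viol a' D < viol a' ?C" if D: "D \<in> set \<Phi>" "D \<noteq> ?C" for D
    proof (cases "i \<in> var ` D")
      case True
      then obtain l where l: "l \<in> D" "var l = i" by blast
      have "viol a' D \<le> 3/4" using viol'_le[OF D(1) l(1)] pf'_i[OF l(2)] by (simp split: if_splits)
      then show ?thesis using viol_violated_ge[OF C worst(2)] viol'_other[OF C notin] by linarith
    next
      case False
      then show ?thesis using worst(3)[OF D] viol'_other[OF D(1)] viol'_other[OF C notin] by simp
    qed
    have pos: "viol a' ?C > 0"
      using viol_violated_ge[OF C worst(2)] viol'_other[OF C notin] by linarith
    show "orc k' a' = Some j"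
    proof (rule answer_cases[OF prob, of k'])
      assume "\<And>D. D \<in> set \<Phi> \<Longrightarrow> viol a' D = 0"
      then show ?thesis using pos C by fastforce
    next
      fix q assume q: "orc k' a' = Some q" "q < length \<Phi>" "\<And>D. D \<in> set \<Phi> \<Longrightarrow> viol a' D \<le> viol a' (\<Phi> ! q)"
      have "\<Phi> ! q = ?C"
      proof (rule ccontr)
        assume "\<Phi> ! q \<noteq> ?C"
        then show False using less[of "\<Phi> ! q"] q(2) q(3)[OF C] by simp
      qed
      \<comment> \<open>Repetition-freeness enters here: the same clause can only be reported under
        the same index.\<close>
      then have "q = j" using rep_free q(2) worst(1) nth_eq_iff_index_eq by (auto simp: repetition_free_def)
      then show ?thesis using q(1) by simp
    qed
  next
    assume ans: "orc k' a' = Some j"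
    show "i \<notin> var ` ?C"
    proof
      assume "i \<in> var ` ?C"
      then obtain l where l: "l \<in> ?C" "var l = i" by blast
      have "\<not> lit_true v l" using worst(2) l(1) by (auto simp: clause_true_def)
      then have small: "viol a' ?C \<le> 1/4" using viol'_le[OF C l(1)] pf'_i[OF l(2)] by simp
      obtain D where D: "D \<in> set \<Phi>" "\<not> clause_true (v(i := \<not> v i)) D"
        using flip by (auto simp: satisfies_def)
      \<comment> \<open>\<open>D\<close> is violated after the flip. A literal of \<open>D\<close>
        on \<open>i\<close> is therefore true under \<open>v\<close> and now false with probability
        3/4; any other literal is false under \<open>v\<close> already.\<close>
      have pf'_D: "3/4 \<le> lit_false_prob a' p"
        if p: "p \<in> D" "var p < n" for p
      proof (cases "var p = i")
        case True
        then have "lit_true v p" using D(2) p by (cases p) (auto simp: clause_true_def)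
        then show ?thesis using pf'_i[OF True] True by simp
      next
        case False
        then have "\<not> lit_true v p" using D(2) p by (cases p) (auto simp: clause_true_def)
        then have "9/10 \<le> lit_false_prob a' p"
          using pf'_other[OF p(2) False] pf_false_ge[OF p(2)] by simp
        then show ?thesis by linarith
      qed
      have "1/4 < viol a' D"
        using D(1)
      proof (cases rule: clause_cases)
        case (unit p)
        then show ?thesis using pf'_D[of p] by (simp add: viol_def)
      next
        case (pair p q)
        then have "3/4 * (3/4) \<le> lit_false_prob a' p * lit_false_prob a' q"
          using pf'_D[of p] pf'_D[of q] by (intro mult_mono) auto
        then show ?thesis using pair by (simp add: viol_def)
      qed
      moreover have "viol a' D \<le> viol a' ?C"
      proof (rule answer_cases[OF prob, of k'])
        assume "orc k' a' = None"
        then show ?thesis using ans by simp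
      next
        fix q assume "orc k' a' = Some q" "\<And>D. D \<in> set \<Phi> \<Longrightarrow> viol a' D \<le> viol a' (\<Phi> ! q)"
        then show ?thesis using ans D(1) by simp
      qed
      ultimately show False using small by linarith
    qed
  qed
qed

end

section \<open>Consequences of the worst clause for a partial assignment\<close>

context hidden_2sat
begin

text \<open>What is learned about a partial assignment \<open>A\<close> from the number \<open>c\<close> of free variables in the
  worst clause, the free variables being given the value \<open>b\<close>; \<open>t\<close> is one of these variables.\<close>

definition identified :: "(nat \<Rightarrow> nat) \<Rightarrow> nat \<Rightarrow> nat \<Rightarrow> nat \<Rightarrow> bool" where
  "identified A b c t \<longleftrightarrow>
     (c = 0 \<longrightarrow> (\<forall>w. extends n w A \<longrightarrow> \<not> satisfies w \<Phi>)) \<and>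
     (c = 1 \<longrightarrow> t < n \<and> A t = 0 \<and> (\<forall>w. extends n w A \<and> satisfies w \<Phi> \<longrightarrow> w t = (b = 0))) \<and>
     (c \<ge> 2 \<longrightarrow> (\<forall>C\<in>set \<Phi>. \<not> clause_true (filled A b) C \<longrightarrow> (\<forall>l\<in>C. A (var l) = 0)))"

text \<open>An assigned variable outranks the sum of any two free ones, so that clauses touching assigned
  variables are preferred by the oracle.\<close>

definition rank :: "(nat \<Rightarrow> nat) \<Rightarrow> nat \<Rightarrow> nat" where
  "rank A i = (if A i = 0 then i else 2 * n + i)"

text \<open>Ranks are below \<open>3 * n\<close>, so taking \<open>3 * n\<close> for
  \<open>M\<close> requires a number above \<open>9 * n * n\<close> and at least
  \<open>27 * n\<close>. This one is a simple expression in \<open>n\<close> that the program can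
  evaluate within its word size.\<close>

definition base :: nat where
  "base = 30 * ((n + 1) * (n + 1))"

definition weight :: "(nat \<Rightarrow> nat) \<Rightarrow> nat \<Rightarrow> nat \<Rightarrow> real" where
  "weight A b i = (if filled A b i then real (base + rank A i) else real (3 * n - rank A i)) / real (base + 3 * n)"

lemma weighted_query_weight:
  assumes "\<And>i. i < n \<Longrightarrow> a i = weight A b i" "\<not> satisfies (filled A b) \<Phi>"
  shows "weighted_query n \<Phi> orc (filled A b) (rank A) base (3 * n) a"
proof
  show "inj_on (rank A) {..<n}" by (auto simp: inj_on_def rank_def split: if_splits)
  show "3 * n * (3 * n) < base" "9 * (3 * n) \<le> base" by (simp_all add: base_def algebra_simps)
qed (use assms in \<open>auto simp: rank_def weight_def\<close>)

text \<open>Assigned literals of the worst clause are false in every extension of \<open>A\<close>.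
  With no free variable this is a contradiction; with one, its literal must be true, hence the
  variable takes the value opposite to \<open>b\<close>. With two, the ranks sum to less than
  \<open>2 * n\<close>, whereas a violated clause touching an assigned variable has sum at least
  \<open>2 * n\<close> and would have been worse.\<close>

lemma identified_if_worst:
  assumes a: "\<And>i. i < n \<Longrightarrow> a i = weight A b i" and unsat: "\<not> satisfies (filled A b) \<Phi>"
    and A: "\<And>i. A i \<le> 2" and j: "orc k a = Some j"
    and F: "F = {i. i < n \<and> A i = 0 \<and> i \<in> var ` (\<Phi> ! j)}" and t: "F \<noteq> {} \<Longrightarrow> t \<in> F"
  shows "identified A b (card F) t"
proof -
  interpret weighted_query n \<Phi> orc "filled A b" "rank A" base "3 * n" a
    using weighted_query_weight[OF a unsat] .
  obtain j' where j': "orc k a = Some j'" "j' < length \<Phi>" "\<not> clause_true (filled A b) (\<Phi> ! j')"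
    "\<And>C. C \<in> set \<Phi> \<Longrightarrow> C \<noteq> \<Phi> ! j' \<Longrightarrow> viol a C < viol a (\<Phi> ! j')"
    by (rule worst_clause[of k]) blast
  then have "j' = j" using j by simp
  note j' = j'[unfolded this]
  let ?C = "\<Phi> ! j"
  have C: "?C \<in> set \<Phi>" using j'(2) by simp
  have vars: "var l < n" if "l \<in> ?C" for l using wf[OF C] that by (auto simp: wf_clause_def)
  have finF: "finite F" by (simp add: F)
  have fixed_false: "\<not> lit_true w l" if "extends n w A" "l \<in> ?C" "A (var l) \<noteq> 0" for w l
  proof -
    have "w (var l) = filled A b (var l)"
      using that(1,3) vars[OF that(2)] A[of "var l"]
      by (auto simp: extends_def filled_def fill_def)
    then show ?thesis using j'(3) that(2) by (auto simp: clause_true_def lit_true_iff_of_var split: literal.splits)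
  qed
  have 0: "\<not> satisfies w \<Phi>" if "card F = 0" "extends n w A" for w
  proof -
    have "A (var l) \<noteq> 0" if "l \<in> ?C" for l
      using \<open>card F = 0\<close> finF vars[OF that] that by (auto simp: F)
    then have "\<not> clause_true w ?C" using fixed_false[OF that(2)] by (auto simp: clause_true_def)
    then show ?thesis using C by (auto simp: satisfies_def)
  qed
  have 1: "t < n \<and> A t = 0 \<and> (\<forall>w. extends n w A \<and> satisfies w \<Phi> \<longrightarrow> w t = (b = 0))" if card: "card F = 1"
  proof -
    have "F \<noteq> {}" using card by auto
    then have "t \<in> F" by (rule t)
    then have Ft: "F = {t}" using card by (metis card_1_singletonE singletonD)
    have "w t = (b = 0)" if w: "extends n w A" "satisfies w \<Phi>" for w
    proof -
      obtain l where l: "l \<in> ?C" "lit_true w l" using w(2) C by (auto simp: satisfies_def clause_true_def)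
      then have "A (var l) = 0" using fixed_false[OF w(1)] by blast
      then have "var l \<in> F" using l(1) vars[OF l(1)] by (auto simp: F)
      then have "var l = t" using Ft by simp
      moreover have "\<not> lit_true (filled A b) l" using j'(3) l(1) by (auto simp: clause_true_def)
      ultimately show ?thesis using l(2) \<open>A (var l) = 0\<close>
        by (cases l) (auto simp: filled_def fill_def)
    qed
    then show ?thesis using \<open>t \<in> F\<close> by (auto simp: F)
  qed
  have 2: "A (var l) = 0" if card: "card F \<ge> 2" and D: "D \<in> set \<Phi>" "\<not> clause_true (filled A b) D" "l \<in> D" for D l
  proof (rule ccontr)
    assume touch: "A (var l) \<noteq> 0"
    have "F \<subseteq> var ` ?C" by (auto simp: F)
    moreover have "card (var ` ?C) \<le> 2"
      using card_image_le[of ?C var] wf[OF C] card_le[OF C] by (auto simp: wf_clause_def)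
    moreover have "finite (var ` ?C)" using wf[OF C] by (auto simp: wf_clause_def)
    ultimately have FC: "var ` ?C = F" and cardF: "card F = 2"
      using card card_mono[of "var ` ?C" F] card_subset_eq[of "var ` ?C" F] by auto
    have "rank A ` var ` ?C = (\<lambda>i. i) ` F" unfolding FC by (rule image_cong) (auto simp: F rank_def)
    then have rankC: "rank A ` var ` ?C = F" by simp
    obtain x y where xy: "viol a ?C = real ((base + x) * (base + y)) / real ((base + 3 * n) * (base + 3 * n))"
      "x * y < base" "x \<noteq> y" "{x, y} - {3 * n} = F"
      using viol_violated_eq[OF C j'(3)] rankC by metis
    \<comment> \<open>The filler stands for the missing literal of a unit clause; it cannot occur
      because \<open>F\<close> has two elements.\<close>
    have "3 * n \<notin> {x, y}"
    proof
      assume "3 * n \<in> {x, y}"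
      then have "card ({x, y} - {3 * n}) = 1" using xy(3) by auto
      then show False using cardF xy(4) by simp
    qed
    then have "{x, y} = F" using xy(4) by blast
    moreover have "\<forall>i\<in>F. i < n" by (simp add: F)
    ultimately have lt: "x < n" "y < n" by blast+
    obtain x' y' where xy': "viol a D = real ((base + x') * (base + y')) / real ((base + 3 * n) * (base + 3 * n))"
      "{x', y'} - {3 * n} = rank A ` var ` D"
      using viol_violated_eq[OF D(1,2)] by metis
    \<comment> \<open>One summand of \<open>D\<close> is already at least \<open>2 * n\<close>,
      whatever its partner is, while \<open>x\<close> and \<open>y\<close> are both below
      \<open>n\<close>.\<close>
    have "rank A (var l) \<in> {x', y'}" using xy'(2) D(3) by blast
    moreover have "rank A (var l) \<ge> 2 * n" using touch by (simp add: rank_def)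
    ultimately have "x + y < x' + y'" using lt by auto
    then have "(base + x) * (base + y) < (base + x') * (base + y')"
      by (rule shifted_product_less[OF xy(2)])
    then have "viol a ?C < viol a D" unfolding xy(1) xy'(1) using K_pos
      by (intro divide_strict_right_mono) (simp_all only: of_nat_less_iff of_nat_0_less_iff, simp)
    then show False using j'(4)[OF D(1)] by fastforce
  qed
  show ?thesis unfolding identified_def using 0 1 2 by blast
qed

end

section \<open>Weakest preconditions with running time\<close>

text \<open>Total correctness: termination, absence of stuck stores and the time are all part of the
  claim. Since execution is deterministic, the existential speaks about the run of the program. For
  loop-free commands the rules are equivalences, so simplification acts as symbolic
  execution.\<close>

definition wp :: "nat \<Rightarrow> nat \<Rightarrow> oracle_fun \<Rightarrow> com \<Rightarrow> state \<Rightarrow> (nat \<Rightarrow> state \<Rightarrow> bool) \<Rightarrow> bool" where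
  "wp n W orc c s Q \<longleftrightarrow> (\<exists>t s'. exec n W orc c s t s' \<and> Q t s')"

lemma wp_mono: "wp n W orc c s Q \<Longrightarrow> (\<And>t s'. Q t s' \<Longrightarrow> Q' t s') \<Longrightarrow> wp n W orc c s Q'"
  by (auto simp: wp_def)

inductive_cases exec_cases:
  "exec n W orc Skip s t s'" "exec n W orc (Assign x e) s t s'" "exec n W orc (Store x e f) s t s'"
  "exec n W orc (SetProb e f g) s t s'" "exec n W orc (Query x) s t s'" "exec n W orc (Seq c d) s t s'"
  "exec n W orc (Cond b c d) s t s'"

lemma wp_Skip [simp]: "wp n W orc Skip s Q \<longleftrightarrow> Q 1 s"
  unfolding wp_def One_nat_def by (blast elim: exec_cases intro: exec.intros[unfolded One_nat_def])

lemma wp_Assign [simp]: "wp n W orc (Assign x e) s Q \<longleftrightarrow>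
    aval e s < W \<and> Q 1 (s\<lparr>scalar := (scalar s)(x := aval e s)\<rparr>)"
  unfolding wp_def One_nat_def by (blast elim: exec_cases intro: exec.intros[unfolded One_nat_def])

lemma wp_Store [simp]: "wp n W orc (Store x e f) s Q \<longleftrightarrow> aval e s < W \<and> aval f s < W \<and>
    Q 1 (s\<lparr>array := (array s)(x := (array s x)(aval e s := aval f s))\<rparr>)"
  unfolding wp_def One_nat_def by (blast elim: exec_cases intro: exec.intros[unfolded One_nat_def])

lemma wp_SetProb [simp]: "wp n W orc (SetProb e f g) s Q \<longleftrightarrow>
    aval e s < n \<and> aval f s \<le> aval g s \<and> 0 < aval g s \<and> aval g s < W \<and>
    Q 1 (s\<lparr>probs := (probs s)(aval e s := real (aval f s) / real (aval g s))\<rparr>)"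
  unfolding wp_def One_nat_def by (blast elim: exec_cases intro: exec.intros[unfolded One_nat_def])

lemma wp_Query [simp]: "wp n W orc (Query x) s Q \<longleftrightarrow>
    answer_word (orc (queries s) (probs s)) < W \<and>
    Q 1 (s\<lparr>scalar := (scalar s)(x := answer_word (orc (queries s) (probs s))), queries := Suc (queries s)\<rparr>)"
  unfolding wp_def One_nat_def by (blast elim: exec_cases intro: exec.intros[unfolded One_nat_def])

lemma wp_Seq [simp]: "wp n W orc (Seq c d) s Q \<longleftrightarrow>
    wp n W orc c s (\<lambda>t s'. wp n W orc d s' (\<lambda>t' s''. Q (t + t') s''))"
  unfolding wp_def by (fastforce elim: exec_cases intro: exec.intros)

lemma wp_Cond [simp]: "wp n W orc (Cond b c d) s Q \<longleftrightarrow>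
    (if bval b s then wp n W orc c s (\<lambda>t. Q (Suc t)) else wp n W orc d s (\<lambda>t. Q (Suc t)))"
proof (cases "bval b s")
  case True
  then show ?thesis unfolding wp_def by (auto elim!: exec_cases intro: exec.CondTrue)
next
  case False
  then show ?thesis unfolding wp_def by (auto elim!: exec_cases intro: exec.CondFalse)
qed

text \<open>The potential method: an iteration pays its own time and one unit for the guard out of
  the drop of \<open>pot\<close>, which also gives termination. Keeping \<open>pot s'\<close> on the
  left lets unspent potential be passed on to an enclosing loop; the final 1 is the failing
  guard.\<close>

lemma wp_While:
  fixes pot :: "state \<Rightarrow> nat"
  assumes "I s"
    and "\<And>s. I s \<Longrightarrow> bval b s \<Longrightarrow> wp n W orc c s (\<lambda>t s'. I s' \<and> t + 1 + pot s' \<le> pot s)"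
  shows "wp n W orc (While b c) s (\<lambda>t s'. I s' \<and> \<not> bval b s' \<and> t + pot s' \<le> pot s + 1)"
  using assms(1)
proof (induction "pot s" arbitrary: s rule: less_induct)
  case less
  show ?case
  proof (cases "bval b s")
    case False
    then show ?thesis unfolding wp_def using less.prems exec.WhileFalse[OF False]
      by (intro exI[of _ 1] exI[of _ s]) simp
  next
    case True
    obtain t s' where 1: "exec n W orc c s t s'" "I s'" "t + 1 + pot s' \<le> pot s"
      using assms(2)[OF less.prems True] by (auto simp: wp_def)
    then obtain t' s'' where 2: "exec n W orc (While b c) s' t' s''" "I s''" "\<not> bval b s''"
      "t' + pot s'' \<le> pot s' + 1"
      using less.hyps[of s'] by (auto simp: wp_def)
    show ?thesis unfolding wp_def
      by (rule exI[of _ "Suc (t + t')"], rule exI[of _ s''])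
        (use 1 2 exec.WhileTrue[OF True 1(1) 2(1)] in simp)
  qed
qed

definition for_loop :: "com \<Rightarrow> com" where
  "for_loop c = Seq (Assign ''i'' (Num 0)) (While (Less (Var ''i'') (Var ''n''))
     (Seq c (Assign ''i'' (Plus (Var ''i'') (Num 1)))))"

text \<open>Each iteration adds a guard and an increment to the body; initialisation and the last
  guard give the remaining 2.\<close>

lemma wp_for_loop:
  assumes "n < W" "scalar s ''n'' = n" "I 0 (s\<lparr>scalar := (scalar s)(''i'' := 0)\<rparr>)"
    and body: "\<And>k s. k < n \<Longrightarrow> scalar s ''i'' = k \<Longrightarrow> scalar s ''n'' = n \<Longrightarrow> I k s \<Longrightarrow>
      wp n W orc c s (\<lambda>t s'. t \<le> B \<and> scalar s' ''i'' = k \<and> scalar s' ''n'' = n \<and>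
        I (Suc k) (s'\<lparr>scalar := (scalar s')(''i'' := Suc k)\<rparr>))"
  shows "wp n W orc (for_loop c) s (\<lambda>t s'. t \<le> (B + 2) * n + 2 \<and> I n s' \<and> scalar s' ''n'' = n)"
proof -
  let ?J = "\<lambda>s. scalar s ''n'' = n \<and> scalar s ''i'' \<le> n \<and> I (scalar s ''i'') s"
  let ?pot = "\<lambda>s. (B + 2) * (n - scalar s ''i'')"
  let ?s0 = "s\<lparr>scalar := (scalar s)(''i'' := 0)\<rparr>"
  have "wp n W orc (While (Less (Var ''i'') (Var ''n'')) (Seq c (Assign ''i'' (Plus (Var ''i'') (Num 1))))) ?s0
      (\<lambda>t s'. ?J s' \<and> \<not> bval (Less (Var ''i'') (Var ''n'')) s' \<and> t + ?pot s' \<le> ?pot ?s0 + 1)"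
  proof (rule wp_While)
    show "?J ?s0" using assms(2,3) by simp
  next
    fix s assume J: "?J s" and less: "bval (Less (Var ''i'') (Var ''n'')) s"
    obtain d where d: "n = scalar s ''i'' + Suc d" using J less less_iff_Suc_add by auto
    have le: "Suc (scalar s ''i'') < W" using J less assms(1) by simp
    have "wp n W orc c s (\<lambda>t s'. t \<le> B \<and> scalar s' ''i'' = scalar s ''i'' \<and> scalar s' ''n'' = n \<and>
        I (Suc (scalar s ''i'')) (s'\<lparr>scalar := (scalar s')(''i'' := Suc (scalar s ''i''))\<rparr>))"
      using J less by (intro body) auto
    then show "wp n W orc (Seq c (Assign ''i'' (Plus (Var ''i'') (Num 1)))) s
        (\<lambda>t s'. ?J s' \<and> t + 1 + ?pot s' \<le> ?pot s)"
      unfolding wp_Seq by (rule wp_mono) (use d le in \<open>simp add: algebra_simps\<close>)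
  qed
  then show ?thesis unfolding for_loop_def wp_Seq wp_Assign
    using assms(1) by (auto elim!: wp_mono)
qed

section \<open>The program\<close>

text \<open>Cell \<open>s n + i\<close> of the array \<open>a\<close> is the value of variable \<open>i\<close> in the partial assignment
  explored on side \<open>s\<close>.\<close>

definition is_free :: bexp where
  "is_free = Equal (Read ''a'' (Plus (Times (Var ''s'') (Var ''n'')) (Var ''i''))) (Num 0)"

definition not_done :: bexp where
  "not_done = Equal (Var ''done'') (Num 0)"

text \<open>The completion goes to \<open>out\<close> as well as to the query, so that a report of
  satisfaction finds the solution already in place.\<close>

definition load :: com where
  "load = for_loop (Seq
     (Cond is_free (Store ''out'' (Var ''i'') (Var ''b''))
       (Store ''out'' (Var ''i'') (Minus (Read ''a'' (Plus (Times (Var ''s'') (Var ''n'')) (Var ''i''))) (Num 1))))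
     (SetProb (Var ''i'') (Read ''out'' (Var ''i'')) (Num 1)))"

text \<open>The guard \<open>not_done\<close> replaces a loop exit: after a success the remaining
  iterations do nothing. After a failure the cell of the query is restored.\<close>

definition try_flips :: com where
  "try_flips = for_loop (Cond (BAnd is_free not_done)
     (Seq (SetProb (Var ''i'') (Minus (Num 1) (Var ''b'')) (Num 1))
     (Seq (Query ''q'')
       (Cond (Equal (Var ''q'') (Num 0))
         (Seq (Store ''out'' (Var ''i'') (Minus (Num 1) (Var ''b''))) (Assign ''done'' (Num 1)))
         (SetProb (Var ''i'') (Var ''b'') (Num 1)))))
     Skip)"

definition base_exp :: aexp where
  "base_exp = Times (Num 30) (Times (Plus (Var ''n'') (Num 1)) (Plus (Var ''n'') (Num 1)))"

definition set_weight :: com where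
  "set_weight = Seq
     (Cond is_free (Assign ''m'' (Var ''i'')) (Assign ''m'' (Plus (Times (Num 2) (Var ''n'')) (Var ''i''))))
     (Cond (Equal (Read ''out'' (Var ''i'')) (Num 0))
       (SetProb (Var ''i'') (Minus (Times (Num 3) (Var ''n'')) (Var ''m'')) (Plus base_exp (Times (Num 3) (Var ''n''))))
       (SetProb (Var ''i'') (Plus base_exp (Var ''m'')) (Plus base_exp (Times (Num 3) (Var ''n'')))))"

text \<open>A free variable is filled with \<open>b\<close>, and \<open>(3 - 2 * b) / 4\<close> is
  most of the way to its opposite value; \<open>set_weight\<close> restores the cell afterwards.
  \<open>t\<close> keeps the last variable detected, which is the only one if \<open>cnt\<close>
  ends at 1.\<close>

definition count_free :: com where
  "count_free = for_loop (Cond is_free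
     (Seq (SetProb (Var ''i'') (Minus (Num 3) (Times (Num 2) (Var ''b''))) (Num 4))
     (Seq (Query ''q'')
     (Seq (Cond (Equal (Var ''q'') (Var ''j'')) Skip
            (Seq (Assign ''cnt'' (Plus (Var ''cnt'') (Num 1))) (Assign ''t'' (Var ''i''))))
       set_weight)))
     Skip)"

definition identify :: com where
  "identify = Seq load (Seq (Query ''q'')
     (Cond (Equal (Var ''q'') (Num 0)) (Assign ''done'' (Num 1))
     (Seq try_flips
     (Cond not_done
       (Seq (for_loop set_weight) (Seq (Query ''j'') (Seq (Assign ''cnt'' (Num 0)) count_free)))
       Skip))))"

text \<open>Probabilities and the query counter are left unconstrained: every identification reloads
  the whole query, and the oracle lemmas hold for every counter value.\<close>

definition frame :: "vname set \<Rightarrow> vname set \<Rightarrow> state \<Rightarrow> state \<Rightarrow> bool" where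
  "frame X Y s s' \<longleftrightarrow> (\<forall>x. x \<notin> X \<longrightarrow> scalar s' x = scalar s x) \<and> (\<forall>y. y \<notin> Y \<longrightarrow> array s' y = array s y)"

lemma frame_refl: "frame X Y s s"
  by (simp add: frame_def)

lemma frame_trans: "frame X Y s s' \<Longrightarrow> frame X Y s' s'' \<Longrightarrow> frame X Y s s''"
  by (simp add: frame_def)

lemma frame_mono: "frame X Y s s' \<Longrightarrow> X \<subseteq> X' \<Longrightarrow> Y \<subseteq> Y' \<Longrightarrow> frame X' Y' s s'"
  by (auto simp: frame_def)

lemma frame_scalar: "frame X Y s s' \<Longrightarrow> x \<notin> X \<Longrightarrow> scalar s' x = scalar s x"
  by (simp add: frame_def)

lemma frame_scalar_upd: "x \<in> X \<Longrightarrow> frame X Y s s' \<Longrightarrow> frame X Y s (s'\<lparr>scalar := (scalar s')(x := c)\<rparr>)"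
  by (auto simp: frame_def)

lemma output_assignment_eq: "output_assignment s = (\<lambda>i. array s ''out'' i \<noteq> 0)"
  by (simp add: fun_eq_iff output_assignment_def)

text \<open>The default 0 beyond \<open>n\<close> hides the neighbouring block, so that invariants
  can quantify over all indices and sides can be compared as functions.\<close>

definition side :: "nat \<Rightarrow> state \<Rightarrow> nat \<Rightarrow> nat \<Rightarrow> nat" where
  "side n st \<sigma> i = (if i < n then array st ''a'' (\<sigma> * n + i) else 0)"

abbreviation ident_scalars :: "vname set" where
  "ident_scalars \<equiv> {''i'', ''q'', ''m'', ''j'', ''cnt'', ''t'', ''done''}"

section \<open>Correctness and linear running time of an identification\<close>

context hidden_2sat
begin

text \<open>The exponent absorbs a constant factor: \<open>(n + 2) ^ 5\<close> is at least 32, and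
  \<open>32 * (n + 2) ^ 2\<close> dominates \<open>base + 3 * n\<close> and the number of clauses
  for every \<open>n\<close>, including 0.\<close>

definition W :: nat where
  "W = (n + 2) ^ 7"

lemma W_large: "32 * (n * n) + 128 * n + 128 \<le> W"
proof -
  have "(2::nat) ^ 5 * (n + 2) ^ 2 \<le> (n + 2) ^ 5 * (n + 2) ^ 2"
    by (intro mult_right_mono power_mono) auto
  also have "\<dots> = W" by (simp add: W_def flip: power_add)
  finally show ?thesis by (simp add: power2_eq_square algebra_simps)
qed

lemma base_less_W: "base + 3 * n < W" "3 * n < W" "4 < W"
  and answer_less_W: "prob_assignment n a \<Longrightarrow> answer_word (orc k a) < W"
  using W_large answer_word_le[of a k] by (simp_all add: base_def algebra_simps)

definition solved :: "state \<Rightarrow> bool" where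
  "solved s \<longleftrightarrow> scalar s ''done'' = 1 \<and> satisfies (output_assignment s) \<Phi>"

definition ready :: "state \<Rightarrow> bool" where
  "ready s \<longleftrightarrow> scalar s ''n'' = n \<and> scalar s ''s'' \<le> 1 \<and> scalar s ''b'' \<le> 1 \<and> scalar s ''done'' = 0 \<and>
     (\<forall>i. side n s (scalar s ''s'') i \<le> 2)"

abbreviation cur :: "state \<Rightarrow> nat \<Rightarrow> nat" where
  "cur s \<equiv> side n s (scalar s ''s'')"

lemma frame_cur:
  assumes "frame X Y s0 s" "''s'' \<notin> X" "''a'' \<notin> Y"
  shows "cur s = cur s0"
  using assms by (auto simp: side_def frame_def)

lemma cur_eq: "i < n \<Longrightarrow> array s ''a'' (scalar s ''s'' * n + i) = cur s i"
  by (simp add: side_def)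

lemma fill_le: "ready s \<Longrightarrow> fill (cur s) (scalar s ''b'') i \<le> 1"
proof -
  assume "ready s"
  then have "scalar s ''b'' \<le> 1" "cur s i \<le> 2" by (auto simp: ready_def)
  then show ?thesis by (auto simp: fill_def)
qed

lemma wp_load:
  assumes r: "ready s0"
  shows "wp n W orc load s0 (\<lambda>t s. t \<le> 5 * n + 2 \<and> frame {''i''} {''out''} s0 s \<and>
    (\<forall>l<n. array s ''out'' l = fill (cur s0) (scalar s0 ''b'') l \<and>
      probs s l = real (fill (cur s0) (scalar s0 ''b'') l)))"
proof -
  let ?I = "\<lambda>k s. frame {''i''} {''out''} s0 s \<and>
    (\<forall>l<k. array s ''out'' l = fill (cur s0) (scalar s0 ''b'') l \<and>
      probs s l = real (fill (cur s0) (scalar s0 ''b'') l))"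
  have n: "n < W" using base_less_W by simp
  show ?thesis unfolding load_def
  proof (rule wp_mono[OF wp_for_loop[where I = ?I and B = 3, OF n]])
    show "scalar s0 ''n'' = n" using r by (simp add: ready_def)
    show "?I 0 (s0\<lparr>scalar := (scalar s0)(''i'' := 0)\<rparr>)" by (simp add: frame_def)
  next
    fix k s assume k: "k < n" "scalar s ''i'' = k" "scalar s ''n'' = n" and I: "?I k s"
    have f: "frame {''i''} {''out''} s0 s" using I by simp
    note cell = cur_eq[OF k(1), of s0]
    have 1: "fill (cur s0) (scalar s0 ''b'') k \<le> 1" by (rule fill_le[OF r])
    have "is_c": "(if cur s0 k = 0 then scalar s0 ''b'' else cur s0 k - 1) = fill (cur s0) (scalar s0 ''b'') k"
      by (simp add: fill_def)
    have 2: "fill (cur s0) (scalar s0 ''b'') k < W" "Suc 0 < W" using 1 base_less_W(3) by simp_all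
    show "wp n W orc (Seq (Cond is_free (Store ''out'' (Var ''i'') (Var ''b''))
       (Store ''out'' (Var ''i'') (Minus (Read ''a'' (Plus (Times (Var ''s'') (Var ''n'')) (Var ''i''))) (Num 1))))
     (SetProb (Var ''i'') (Read ''out'' (Var ''i'')) (Num 1))) s
      (\<lambda>t s'. t \<le> 3 \<and> scalar s' ''i'' = k \<and> scalar s' ''n'' = n \<and>
        ?I (Suc k) (s'\<lparr>scalar := (scalar s')(''i'' := Suc k)\<rparr>))"
      using I k n 1 2 is_c
      by (cases "cur s0 k = 0") (simp_all add: is_free_def cell frame_def less_Suc_eq)
  qed (use r in \<open>auto simp: ready_def\<close>)
qed

lemma output_assignment_cong:
  assumes "\<And>l. l < n \<Longrightarrow> array s ''out'' l = fill A b l"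
  shows "satisfies (output_assignment s) \<Phi> = satisfies (filled A b) \<Phi>"
  by (rule satisfies_cong) (simp add: output_assignment_eq filled_def assms)

definition flip :: "(nat \<Rightarrow> bool) \<Rightarrow> nat \<Rightarrow> nat \<Rightarrow> bool" where
  "flip v i = v(i := \<not> v i)"

lemma wp_try_flips:
  assumes r: "ready s0"
    and out: "\<And>l. l < n \<Longrightarrow> array s0 ''out'' l = fill (cur s0) (scalar s0 ''b'') l"
    and pr: "\<And>l. l < n \<Longrightarrow> probs s0 l = real (fill (cur s0) (scalar s0 ''b'') l)"
  shows "wp n W orc try_flips s0 (\<lambda>t s. t \<le> 8 * n + 2 \<and> frame {''i'', ''q'', ''done''} {''out''} s0 s \<and>
    (solved s \<or> scalar s ''done'' = 0 \<and> array s ''out'' = array s0 ''out'' \<and>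
      (\<forall>l<n. cur s0 l = 0 \<longrightarrow> \<not> satisfies (flip (filled (cur s0) (scalar s0 ''b'')) l) \<Phi>)))"
proof -
  let ?A = "cur s0" and ?b = "scalar s0 ''b''"
  let ?X = "{''i'', ''q'', ''done''}"
  let ?I = "\<lambda>k s. frame ?X {''out''} s0 s \<and>
    (solved s \<or> scalar s ''done'' = 0 \<and> array s ''out'' = array s0 ''out'' \<and>
      (\<forall>l<n. probs s l = real (fill ?A ?b l)) \<and>
      (\<forall>l<k. ?A l = 0 \<longrightarrow> \<not> satisfies (flip (filled ?A ?b) l) \<Phi>))"
  have n: "n < W" "Suc 0 < W" using base_less_W by simp_all
  have b: "?b \<le> 1" using r by (simp add: ready_def)
  show ?thesis unfolding try_flips_def
  proof (rule wp_mono[OF wp_for_loop[where I = ?I and B = 6, OF n(1)]])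
    show "scalar s0 ''n'' = n" using r by (simp add: ready_def)
    show "?I 0 (s0\<lparr>scalar := (scalar s0)(''i'' := 0)\<rparr>)" using r pr by (simp add: frame_def ready_def)
  next
    fix k s assume k: "k < n" "scalar s ''i'' = k" "scalar s ''n'' = n" and I: "?I k s"
    have f: "frame ?X {''out''} s0 s" using I by simp
    note cell = cur_eq[OF k(1), of s0]
    let ?v = "filled ?A ?b"
    let ?body = "Cond (BAnd is_free not_done)
     (Seq (SetProb (Var ''i'') (Minus (Num 1) (Var ''b'')) (Num 1))
     (Seq (Query ''q'')
       (Cond (Equal (Var ''q'') (Num 0))
         (Seq (Store ''out'' (Var ''i'') (Minus (Num 1) (Var ''b''))) (Assign ''done'' (Num 1)))
         (SetProb (Var ''i'') (Var ''b'') (Num 1)))))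
     Skip"
    show "wp n W orc ?body s
      (\<lambda>t s'. t \<le> 6 \<and> scalar s' ''i'' = k \<and> scalar s' ''n'' = n \<and>
        ?I (Suc k) (s'\<lparr>scalar := (scalar s')(''i'' := Suc k)\<rparr>))"
    proof (cases "?A k = 0 \<and> scalar s ''done'' = 0")
      case False
      have bv: "\<not> bval (BAnd is_free not_done) s"
        using False k cell f by (simp add: is_free_def not_done_def frame_def)
      have "?I (Suc k) (s\<lparr>scalar := (scalar s)(''i'' := Suc k)\<rparr>)"
      proof (cases "solved s")
        case True
        then show ?thesis using f by (simp add: frame_def solved_def output_assignment_eq)
      next
        case no: False
        then show ?thesis using I False f by (simp add: frame_def less_Suc_eq)
      qed
      then show ?thesis using bv k by (simp del: bval.simps)
    next
      case True
      then have J: "array s ''out'' = array s0 ''out''" "\<And>l. l < n \<Longrightarrow> probs s l = real (fill ?A ?b l)"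
        "\<And>l. l < k \<Longrightarrow> ?A l = 0 \<Longrightarrow> \<not> satisfies (flip ?v l) \<Phi>"
        using I by (auto simp: solved_def)
      have ck: "fill ?A ?b k = ?b" using True by (simp add: fill_def)
      let ?p = "(probs s)(k := real (1 - ?b))"
      have p: "?p l = of_bool (flip ?v k l)" if "l < n" for l
        using J(2)[OF that] fill_le[OF r, of l] ck b that
        by (cases "l = k") (auto simp: flip_def filled_def of_bool_def)
      have w0: "answer_word (orc (queries s) ?p) = 0 \<longleftrightarrow> satisfies (flip ?v k) \<Phi>"
        by (rule answer_word_eq_0_iff[OF p])
      have wW: "answer_word (orc (queries s) ?p) < W"
      proof (rule answer_less_W, unfold prob_assignment_def, intro allI impI)
        fix l assume "l < n"
        show "0 \<le> ?p l \<and> ?p l \<le> 1" unfolding p[OF \<open>l < n\<close>] by simp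
      qed
      let ?out = "(array s ''out'')(k := 1 - ?b)"
      have so: "satisfies (\<lambda>i. ?out i \<noteq> 0) \<Phi> = satisfies (flip ?v k) \<Phi>"
      proof (rule satisfies_cong)
        fix l assume "l < n"
        then show "(?out l \<noteq> 0) = flip ?v k l"
          using out[of l] J(1) ck b by (cases "l = k") (auto simp: flip_def filled_def)
      qed
      have pk: "(probs s)(k := real ?b) = probs s" using J(2)[OF k(1)] ck by auto
      show ?thesis
      proof (cases "satisfies (flip ?v k) \<Phi>")
        case True
        then show ?thesis using \<open>?A k = 0 \<and> scalar s ''done'' = 0\<close> f k cell w0 wW so b n
          by (simp add: is_free_def not_done_def frame_def solved_def output_assignment_eq)
      next
        case False
        then show ?thesis using \<open>?A k = 0 \<and> scalar s ''done'' = 0\<close> f k cell w0 wW so b n J pk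
          by (auto simp: is_free_def not_done_def frame_def less_Suc_eq)
      qed
    qed
  qed auto
qed

lemma wp_set_weight:
  assumes s: "scalar s ''n'' = n" "scalar s ''i'' = k" "k < n"
    and A: "array s ''a'' (scalar s ''s'' * n + k) = A k" and out: "array s ''out'' k = fill A b k"
    and Q: "\<And>c. Q 4 (s\<lparr>scalar := (scalar s)(''m'' := c), probs := (probs s)(k := weight A b k)\<rparr>)"
  shows "wp n W orc set_weight s Q"
proof -
  have m: "rank A k < 3 * n" using s(3) by (simp add: rank_def)
  have base_pos: "0 < base + 3 * n" by (simp add: base_def)
  have e: "aval base_exp (s\<lparr>scalar := (scalar s)(''m'' := c)\<rparr>) = base" for c
    using s by (simp add: base_exp_def base_def)
  have w: "weight A b k = (if array s ''out'' k = 0 then real (3 * n - rank A k) / real (base + 3 * n)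
      else real (base + rank A k) / real (base + 3 * n))"
    by (simp add: weight_def filled_def out)
  have bv: "bval is_free s \<longleftrightarrow> A k = 0" using s A by (simp add: is_free_def)
  have W: "k < W" "2 * n + k < W" using s(3) base_less_W(2) by simp_all
  have Q': "Q (Suc (Suc (Suc (Suc 0)))) (s\<lparr>scalar := (scalar s)(''m'' := c), probs := (probs s)(k := weight A b k)\<rparr>)" for c
    using Q by (simp add: numeral_eq_Suc)
  show ?thesis
    using s m base_pos base_less_W(1) W Q'[of "rank A k"]
    by (cases "A k = 0"; cases "array s ''out'' k = 0")
      (simp_all add: set_weight_def bv e w rank_def of_nat_diff)
qed

lemma wp_weights:
  assumes r: "ready s0"
    and out: "\<And>l. l < n \<Longrightarrow> array s0 ''out'' l = fill (cur s0) (scalar s0 ''b'') l"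
  shows "wp n W orc (for_loop set_weight) s0 (\<lambda>t s. t \<le> 6 * n + 2 \<and> frame {''i'', ''m''} {} s0 s \<and>
    (\<forall>l<n. probs s l = weight (cur s0) (scalar s0 ''b'') l))"
proof -
  let ?I = "\<lambda>k s. frame {''i'', ''m''} {} s0 s \<and> (\<forall>l<k. probs s l = weight (cur s0) (scalar s0 ''b'') l)"
  have n: "n < W" using base_less_W by simp
  show ?thesis
  proof (rule wp_mono[OF wp_for_loop[where I = ?I and B = 4, OF n]])
    show "scalar s0 ''n'' = n" using r by (simp add: ready_def)
    show "?I 0 (s0\<lparr>scalar := (scalar s0)(''i'' := 0)\<rparr>)" by (simp add: frame_def)
  next
    fix k s assume k: "k < n" "scalar s ''i'' = k" "scalar s ''n'' = n" and I: "?I k s"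
    have cell: "array s ''a'' (scalar s ''s'' * n + k) = cur s0 k"
      using I cur_eq[OF k(1), of s0] by (simp add: frame_def)
    have out_s: "array s ''out'' k = fill (cur s0) (scalar s0 ''b'') k"
      using I out[OF k(1)] by (simp add: frame_def)
    show "wp n W orc set_weight s (\<lambda>t s'. t \<le> 4 \<and> scalar s' ''i'' = k \<and> scalar s' ''n'' = n \<and>
        ?I (Suc k) (s'\<lparr>scalar := (scalar s')(''i'' := Suc k)\<rparr>))"
      by (rule wp_set_weight[OF k(3,2,1) cell out_s]) (use I k in \<open>simp add: frame_def less_Suc_eq\<close>)
  qed auto
qed

text \<open>The loop invariant restores all weights after each test, so that every test differs from
  the query \<open>a\<close> that was answered by \<open>j\<close> in a single variable.\<close>

lemma wp_count_free:
  assumes r: "ready s0"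
    and out: "\<And>l. l < n \<Longrightarrow> array s0 ''out'' l = fill (cur s0) (scalar s0 ''b'') l"
    and pr: "\<And>l. l < n \<Longrightarrow> probs s0 l = weight (cur s0) (scalar s0 ''b'') l"
    and unsat: "\<not> satisfies (filled (cur s0) (scalar s0 ''b'')) \<Phi>"
    and flips: "\<And>l. l < n \<Longrightarrow> cur s0 l = 0 \<Longrightarrow> \<not> satisfies (flip (filled (cur s0) (scalar s0 ''b'')) l) \<Phi>"
    and a: "\<And>l. l < n \<Longrightarrow> a l = weight (cur s0) (scalar s0 ''b'') l" and j: "orc k0 a = Some j"
    and sj: "scalar s0 ''j'' = Suc j" and cnt: "scalar s0 ''cnt'' = 0"
  shows "wp n W orc count_free s0 (\<lambda>t s. t \<le> 12 * n + 2 \<and> frame {''i'', ''q'', ''m'', ''cnt'', ''t''} {} s0 s \<and>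
    identified (cur s0) (scalar s0 ''b'') (scalar s ''cnt'') (scalar s ''t''))"
proof -
  let ?A = "cur s0" and ?b = "scalar s0 ''b''"
  let ?X = "{''i'', ''q'', ''m'', ''cnt'', ''t''}"
  let ?F = "\<lambda>k. {l. l < k \<and> ?A l = 0 \<and> l \<in> var ` (\<Phi> ! j)}"
  let ?I = "\<lambda>k s. frame ?X {} s0 s \<and> (\<forall>l<n. probs s l = weight ?A ?b l) \<and>
    scalar s ''cnt'' = card (?F k) \<and> (?F k \<noteq> {} \<longrightarrow> scalar s ''t'' \<in> ?F k)"
  have n: "n < W" "4 < W" using base_less_W by simp_all
  have b: "?b \<le> 1" using r by (simp add: ready_def)
  interpret weighted_query n \<Phi> orc "filled ?A ?b" "rank ?A" base "3 * n" a
    using weighted_query_weight[OF a unsat] .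
  show ?thesis unfolding count_free_def
  proof (rule wp_mono[OF wp_for_loop[where I = ?I and B = 10, OF n(1)]])
    show "scalar s0 ''n'' = n" using r by (simp add: ready_def)
    show "?I 0 (s0\<lparr>scalar := (scalar s0)(''i'' := 0)\<rparr>)" using pr cnt by (simp add: frame_def)
  next
    fix k s assume k: "k < n" "scalar s ''i'' = k" "scalar s ''n'' = n" and I: "?I k s"
    have f: "frame ?X {} s0 s" using I by blast
    have cell: "array s ''a'' (scalar s ''s'' * n + k) = ?A k"
      using f cur_eq[OF k(1), of s0] by (simp add: frame_def)
    have b_s: "scalar s ''b'' = ?b" and j_s: "scalar s ''j'' = Suc j" using f sj by (simp_all add: frame_def)
    have out_s: "array s ''out'' k = fill ?A ?b k" using f out[OF k(1)] by (simp add: frame_def)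
    have bv: "bval is_free s \<longleftrightarrow> ?A k = 0" using k cell by (simp add: is_free_def)
    have F_Suc: "?F (Suc k) = (if ?A k = 0 \<and> k \<in> var ` (\<Phi> ! j) then insert k (?F k) else ?F k)"
      by (auto simp: less_Suc_eq)
    let ?body = "Cond is_free
     (Seq (SetProb (Var ''i'') (Minus (Num 3) (Times (Num 2) (Var ''b''))) (Num 4))
     (Seq (Query ''q'')
     (Seq (Cond (Equal (Var ''q'') (Var ''j'')) Skip
            (Seq (Assign ''cnt'' (Plus (Var ''cnt'') (Num 1))) (Assign ''t'' (Var ''i''))))
       set_weight)))
     Skip"
    show "wp n W orc ?body s (\<lambda>t s'. t \<le> 10 \<and> scalar s' ''i'' = k \<and> scalar s' ''n'' = n \<and>
        ?I (Suc k) (s'\<lparr>scalar := (scalar s')(''i'' := Suc k)\<rparr>))"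
    proof (cases "?A k = 0")
      case False
      then have "?F (Suc k) = ?F k" using F_Suc by simp
      then show ?thesis using I k False bv by (simp add: frame_def)
    next
      case True
      let ?p = "(probs s)(k := real (3 - 2 * ?b) / 4)"
      let ?w = "answer_word (orc (queries s) ?p)"
      have vk: "filled ?A ?b k \<longleftrightarrow> ?b \<noteq> 0" using True by (simp add: filled_def fill_def)
      have p: "?p l = (if l = k then if filled ?A ?b k then 1/4 else 3/4 else a l)" if "l < n" for l
        using I a[OF that] that vk b by (cases "?b = 0") auto
      have unsat_flip: "\<not> satisfies ((filled ?A ?b)(k := \<not> filled ?A ?b k)) \<Phi>"
        using flips[OF k(1) True] by (simp add: flip_def)
      \<comment> \<open>The two answers compared belong to different query counts.
        \<open>flip_test\<close> allows this, so an oracle that depends on the history does no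
        harm.\<close>
      note test = flip_test[where a' = ?p, OF j k(1) unsat_flip p]
      have wW: "?w < W" by (rule answer_less_W[OF test(1)])
      have wj: "?w = Suc j \<longleftrightarrow> k \<notin> var ` (\<Phi> ! j)"
        using test(2)[of "queries s"] by (cases "orc (queries s) ?p") auto
      have card_W: "Suc (card (?F k)) < W"
      proof -
        have "card (?F k) \<le> card {..<k}" by (rule card_mono) auto
        then show ?thesis using k(1) base_less_W(2) by simp
      qed
      have card_Suc: "card (insert k (?F k)) = Suc (card (?F k))"
        by simp
      have kW: "k < W" using k(1) n(1) by simp
      have b4: "3 - 2 * ?b \<le> 4" by linarith
      define Q where "Q t s' \<longleftrightarrow> t \<le> 10 \<and> scalar s' ''i'' = k \<and> scalar s' ''n'' = n \<and>
        ?I (Suc k) (s'\<lparr>scalar := (scalar s')(''i'' := Suc k)\<rparr>)" for t :: nat and s'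
      have Q: "Q t s'" if "t \<le> 10" "scalar s' ''i'' = k" "scalar s' ''n'' = n" "frame ?X {} s s'"
          "\<And>l. l < n \<Longrightarrow> probs s' l = weight ?A ?b l"
          "scalar s' ''cnt'' = card (?F (Suc k))" "?F (Suc k) \<noteq> {} \<Longrightarrow> scalar s' ''t'' \<in> ?F (Suc k)" for t s'
        unfolding Q_def
      proof (intro conjI)
        show "frame ?X {} s0 (s'\<lparr>scalar := (scalar s')(''i'' := Suc k)\<rparr>)"
          by (rule frame_scalar_upd[OF _ frame_trans[OF f that(4)]]) simp
      qed (use that in simp_all)
      have "wp n W orc ?body s Q"
      proof (cases "k \<in> var ` (\<Phi> ! j)")
        case False
        have F: "?F (Suc k) = ?F k" using F_Suc False by simp
        have w: "?w = Suc j" using wj False by simp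
        show ?thesis
          by (simp add: bv True k kW b_s b4 n(2) j_s wW[unfolded w] w,
            rule wp_set_weight[where A = ?A and b = ?b and k = k],
            (simp_all add: k cell out_s)[5], rule Q, simp_all add: k I frame_def F del: mem_Collect_eq)
      next
        case True': True
        have F: "?F (Suc k) = insert k (?F k)" using F_Suc True True' by simp
        have w: "?w \<noteq> Suc j" using wj True' by simp
        have cnt_s: "scalar s ''cnt'' = card (?F k)" using I by blast
        show ?thesis
          by (simp add: bv True k kW b_s b4 n j_s wW w cnt_s card_W,
            rule wp_set_weight[where A = ?A and b = ?b and k = k],
            (simp_all add: k cell out_s)[5], rule Q, simp_all add: k I frame_def F card_Suc del: mem_Collect_eq)
      qed
      then show ?thesis unfolding Q_def[abs_def] .
    qed
  next
    fix t s assume "t \<le> (10 + 2) * n + 2 \<and> ?I n s \<and> scalar s ''n'' = n"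
    moreover from this have "identified ?A ?b (card (?F n)) (scalar s ''t'')"
      using r by (intro identified_if_worst[OF a unsat _ j]) (auto simp: ready_def)
    ultimately show "t \<le> 12 * n + 2 \<and> frame ?X {} s0 s \<and> identified ?A ?b (scalar s ''cnt'') (scalar s ''t'')"
      by simp
  qed
qed

lemma ready_frame:
  assumes "ready s0" "frame X Y s0 s" "{''n'', ''s'', ''b''} \<inter> X = {}" "''a'' \<notin> Y" "scalar s ''done'' = 0"
  shows "ready s" "cur s = cur s0" "scalar s ''b'' = scalar s0 ''b''"
proof -
  have "''n'' \<notin> X" "''s'' \<notin> X" "''b'' \<notin> X" using assms(3) by auto
  note frame_scalar[OF assms(2) this(1)] frame_scalar[OF assms(2) this(2)] frame_scalar[OF assms(2) this(3)]
    frame_cur[OF assms(2) this(2) assms(4)]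
  then show "ready s" "cur s = cur s0" "scalar s ''b'' = scalar s0 ''b''"
    using assms(1,5) by (simp_all add: ready_def)
qed

text \<open>The four passes \<open>load\<close>, \<open>try_flips\<close>, weighting and
  \<open>count_free\<close> cost \<open>5 * n\<close>, \<open>8 * n\<close>, \<open>6 * n\<close>
  and \<open>12 * n\<close>; the additive constant has some slack.\<close>

lemma wp_identify:
  assumes r: "ready s0"
  shows "wp n W orc identify s0 (\<lambda>t s. t \<le> 31 * n + 20 \<and> frame ident_scalars {''out''} s0 s \<and>
    (solved s \<or> scalar s ''done'' = 0 \<and> identified (cur s0) (scalar s0 ''b'') (scalar s ''cnt'') (scalar s ''t'')))"
proof -
  let ?A = "cur s0" and ?b = "scalar s0 ''b''"
  let ?post = "\<lambda>t s. t \<le> 31 * n + 20 \<and> frame ident_scalars {''out''} s0 s \<and>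
    (solved s \<or> scalar s ''done'' = 0 \<and> identified ?A ?b (scalar s ''cnt'') (scalar s ''t''))"
  have W1: "Suc 0 < W" "0 < W" using base_less_W(3) by simp_all
  let ?weigh = "Seq (for_loop set_weight) (Seq (Query ''j'') (Seq (Assign ''cnt'' (Num 0)) count_free))"
  \<comment> \<open>\<open>t0\<close> is the time already spent on \<open>load\<close> and
    \<open>try_flips\<close>, whose linear part is \<open>13 * n\<close>.\<close>
  have count: "wp n W orc ?weigh s
      (\<lambda>t s'. t + t0 \<le> 31 * n + 20 \<and> frame ident_scalars {''out''} s0 s' \<and>
        scalar s' ''done'' = 0 \<and> identified ?A ?b (scalar s' ''cnt'') (scalar s' ''t''))"
    if f: "frame ident_scalars {''out''} s0 s" and d: "scalar s ''done'' = 0"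
      and out: "\<And>l. l < n \<Longrightarrow> array s ''out'' l = fill ?A ?b l"
      and unsat: "\<not> satisfies (filled ?A ?b) \<Phi>"
      and flips: "\<And>l. l < n \<Longrightarrow> ?A l = 0 \<Longrightarrow> \<not> satisfies (flip (filled ?A ?b) l) \<Phi>"
      and t0: "t0 \<le> 13 * n + 10" for s t0
  proof -
    have r1: "ready s" and cur1: "cur s = ?A" and b1: "scalar s ''b'' = ?b"
      by (rule ready_frame[OF r f]; use d in simp)+
    show ?thesis unfolding wp_Seq
    proof (rule wp_mono[OF wp_weights[OF r1]])
      show "array s ''out'' l = fill (cur s) (scalar s ''b'') l" if "l < n" for l
        unfolding cur1 b1 by (rule out[OF that])
    next
      fix t s' assume s': "t \<le> 6 * n + 2 \<and> frame {''i'', ''m''} {} s s' \<and>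
        (\<forall>l<n. probs s' l = weight (cur s) (scalar s ''b'') l)"
      then have f': "frame {''i'', ''m''} {} s s'" by blast
      have a: "probs s' l = weight ?A ?b l" if "l < n" for l
        using s' that cur1 b1 by simp
      interpret weighted_query n \<Phi> orc "filled ?A ?b" "rank ?A" base "3 * n" "probs s'"
        using weighted_query_weight[OF a unsat] .
      obtain j where j: "orc (queries s') (probs s') = Some j" by (rule worst_clause[of "queries s'"]) blast
      have jW: "Suc j < W" using answer_less_W[OF prob_a, of "queries s'"] j by simp
      let ?s = "s'\<lparr>queries := Suc (queries s'), scalar := (scalar s')(''j'' := Suc j, ''cnt'' := 0)\<rparr>"
      have f'': "frame ident_scalars {''out''} s0 ?s"
        by (rule frame_trans[OF f]) (use f' in \<open>auto simp: frame_def\<close>)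
      have "frame {''i'', ''m'', ''j'', ''cnt''} {} s ?s" using f' by (auto simp: frame_def)
      then have d'': "scalar ?s ''done'' = 0" and out'': "array ?s ''out'' = array s ''out''"
        using d by (auto simp: frame_def)
      have r2: "ready ?s" and cur2: "cur ?s = ?A" and b2: "scalar ?s ''b'' = ?b"
        by (rule ready_frame[OF r f'']; use d'' in simp)+
      have "wp n W orc count_free ?s (\<lambda>t s. t \<le> 12 * n + 2 \<and>
          frame {''i'', ''q'', ''m'', ''cnt'', ''t''} {} ?s s \<and>
          identified (cur ?s) (scalar ?s ''b'') (scalar s ''cnt'') (scalar s ''t''))"
      proof (rule wp_count_free[where a = "probs s'", OF r2 _ _ _ _ _ j])
        show "array ?s ''out'' l = fill (cur ?s) (scalar ?s ''b'') l" if "l < n" for l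
          unfolding cur2 b2 out'' by (rule out[OF that])
        show "probs ?s l = weight (cur ?s) (scalar ?s ''b'') l" if "l < n" for l
          unfolding cur2 b2 using a[OF that] by simp
        show "probs s' l = weight (cur ?s) (scalar ?s ''b'') l" if "l < n" for l
          unfolding cur2 b2 using a[OF that] by simp
        show "\<not> satisfies (filled (cur ?s) (scalar ?s ''b'')) \<Phi>"
          unfolding cur2 b2 by (rule unsat)
        show "\<not> satisfies (flip (filled (cur ?s) (scalar ?s ''b'')) l) \<Phi>" if "l < n" "cur ?s l = 0" for l
          unfolding cur2 b2 by (rule flips[OF that(1)]) (use that(2) cur2 in simp)
      qed simp_all
      then have "wp n W orc count_free ?s (\<lambda>t' s''. (t + (1 + (1 + t'))) + t0 \<le> 31 * n + 20 \<and>
          frame ident_scalars {''out''} s0 s'' \<and> scalar s'' ''done'' = 0 \<and>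
          identified ?A ?b (scalar s'' ''cnt'') (scalar s'' ''t''))"
      proof (rule wp_mono)
        fix t' s'' assume s'': "t' \<le> 12 * n + 2 \<and> frame {''i'', ''q'', ''m'', ''cnt'', ''t''} {} ?s s'' \<and>
          identified (cur ?s) (scalar ?s ''b'') (scalar s'' ''cnt'') (scalar s'' ''t'')"
        then have fr: "frame {''i'', ''q'', ''m'', ''cnt'', ''t''} {} ?s s''" by blast
        have "frame ident_scalars {''out''} s0 s''"
          by (rule frame_trans[OF f'' frame_mono[OF fr]]) auto
        moreover have "scalar s'' ''done'' = 0"
          using frame_scalar[OF fr, of "''done''"] d'' by simp
        moreover have "identified ?A ?b (scalar s'' ''cnt'') (scalar s'' ''t'')"
          using s'' unfolding cur2 b2 by blast
        moreover have "(t + (1 + (1 + t'))) + t0 \<le> 31 * n + 20" using s' s'' t0 by linarith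
        ultimately show "(t + (1 + (1 + t'))) + t0 \<le> 31 * n + 20 \<and>
          frame ident_scalars {''out''} s0 s'' \<and> scalar s'' ''done'' = 0 \<and>
          identified ?A ?b (scalar s'' ''cnt'') (scalar s'' ''t'')" by blast
      qed
      then show "wp n W orc (Query ''j'') s' (\<lambda>t1 s''. wp n W orc (Assign ''cnt'' (Num 0)) s''
          (\<lambda>t2 s''. wp n W orc count_free s'' (\<lambda>t3 s'. t + (t1 + (t2 + t3)) + t0 \<le> 31 * n + 20 \<and>
            frame ident_scalars {''out''} s0 s' \<and> scalar s' ''done'' = 0 \<and>
            identified ?A ?b (scalar s' ''cnt'') (scalar s' ''t''))))"
        using jW W1 by (simp add: j)
    qed
  qed
  let ?rest = "Cond (Equal (Var ''q'') (Num 0)) (Assign ''done'' (Num 1))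
     (Seq try_flips (Cond not_done ?weigh Skip))"
  have "wp n W orc (Seq load (Seq (Query ''q'') ?rest)) s0 ?post"
    unfolding wp_Seq[of _ _ _ load] wp_Seq[of _ _ _ "Query ''q''"]
  proof (rule wp_mono[OF wp_load[OF r]])
    fix t s1 assume s1: "t \<le> 5 * n + 2 \<and> frame {''i''} {''out''} s0 s1 \<and>
      (\<forall>l<n. array s1 ''out'' l = fill ?A ?b l \<and> probs s1 l = real (fill ?A ?b l))"
    then have f1: "frame {''i''} {''out''} s0 s1" and out1: "\<And>l. l < n \<Longrightarrow> array s1 ''out'' l = fill ?A ?b l"
      and p1: "\<And>l. l < n \<Longrightarrow> probs s1 l = real (fill ?A ?b l)" and t: "t \<le> 5 * n + 2" by auto
    have p: "probs s1 l = of_bool (filled ?A ?b l)" if "l < n" for l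
      using p1[OF that] fill_le[OF r, of l] by (auto simp: filled_def of_bool_def)
    let ?w = "answer_word (orc (queries s1) (probs s1))"
    have w0: "?w = 0 \<longleftrightarrow> satisfies (filled ?A ?b) \<Phi>" by (rule answer_word_eq_0_iff[OF p])
    have wW: "?w < W" by (rule answer_less_W) (simp add: prob_assignment_def p)
    have d1: "scalar s1 ''done'' = 0" using f1 r by (simp add: frame_def ready_def)
    let ?s = "s1\<lparr>scalar := (scalar s1)(''q'' := ?w), queries := Suc (queries s1)\<rparr>"
    have f2: "frame ident_scalars {''out''} s0 ?s" using f1 by (auto simp: frame_def)
    have "wp n W orc ?rest ?s (\<lambda>t'. ?post (t + (1 + t')))"
    proof (cases "?w = 0")
      case True
      then have "satisfies (output_assignment s1) \<Phi>"
        using w0 output_assignment_cong[OF out1] by simp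
      then show ?thesis using True t W1 f2
        by (simp add: solved_def output_assignment_eq frame_def)
    next
      case False
      have unsat: "\<not> satisfies (filled ?A ?b) \<Phi>" using False w0 by simp
      have d2: "scalar ?s ''done'' = 0" using d1 by simp
      have r2: "ready ?s" and cur2: "cur ?s = ?A" and b2: "scalar ?s ''b'' = ?b"
        by (rule ready_frame[OF r f2]; use d2 in simp)+
      have "wp n W orc try_flips ?s (\<lambda>t s. t \<le> 8 * n + 2 \<and> frame {''i'', ''q'', ''done''} {''out''} ?s s \<and>
        (solved s \<or> scalar s ''done'' = 0 \<and> array s ''out'' = array ?s ''out'' \<and>
          (\<forall>l<n. cur ?s l = 0 \<longrightarrow> \<not> satisfies (flip (filled (cur ?s) (scalar ?s ''b'')) l) \<Phi>)))"
      proof (rule wp_try_flips[OF r2])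
        show "array ?s ''out'' l = fill (cur ?s) (scalar ?s ''b'') l" if "l < n" for l
          unfolding cur2 b2 using out1[OF that] by simp
        show "probs ?s l = real (fill (cur ?s) (scalar ?s ''b'') l)" if "l < n" for l
          unfolding cur2 b2 using p1[OF that] by simp
      qed
      then have "wp n W orc try_flips ?s (\<lambda>t1 s. wp n W orc (Cond not_done ?weigh Skip) s
          (\<lambda>t2. ?post (t + (1 + Suc (t1 + t2)))))"
      proof (rule wp_mono)
        fix t1 s assume s: "t1 \<le> 8 * n + 2 \<and> frame {''i'', ''q'', ''done''} {''out''} ?s s \<and>
          (solved s \<or> scalar s ''done'' = 0 \<and> array s ''out'' = array ?s ''out'' \<and>
          (\<forall>l<n. cur ?s l = 0 \<longrightarrow> \<not> satisfies (flip (filled (cur ?s) (scalar ?s ''b'')) l) \<Phi>))"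
        then have "frame {''i'', ''q'', ''done''} {''out''} ?s s" by blast
        from frame_trans[OF f2 frame_mono[OF this]]
        have f3: "frame ident_scalars {''out''} s0 s" by auto
        show "wp n W orc (Cond not_done ?weigh Skip) s (\<lambda>t2. ?post (t + (1 + Suc (t1 + t2))))"
        proof (cases "solved s")
          case True
          then show ?thesis using s t f3 by (simp add: not_done_def solved_def)
        next
          case False
          then have s': "scalar s ''done'' = 0" "array s ''out'' = array s1 ''out''"
            "\<And>l. l < n \<Longrightarrow> ?A l = 0 \<Longrightarrow> \<not> satisfies (flip (filled ?A ?b) l) \<Phi>"
            using s unfolding cur2 b2 by auto
          have "wp n W orc ?weigh s
            (\<lambda>t' s'. t' + (t + t1 + 3) \<le> 31 * n + 20 \<and> frame ident_scalars {''out''} s0 s' \<and>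
              scalar s' ''done'' = 0 \<and> identified ?A ?b (scalar s' ''cnt'') (scalar s' ''t''))"
            using s t by (intro count[OF f3 s'(1) _ unsat s'(3)]) (simp_all add: s'(2) out1)
          then have "wp n W orc ?weigh s (\<lambda>t2. ?post (t + (1 + Suc (t1 + Suc t2))))"
            by (rule wp_mono) simp
          then show ?thesis using s'(1) by (simp add: not_done_def del: wp_Seq)
        qed
      qed
      then show ?thesis unfolding wp_Cond[of _ _ _ "Equal (Var ''q'') (Num 0)"] wp_Seq[of _ _ _ try_flips]
        using False by (simp del: wp_Seq wp_Cond)
    qed
    then show "wp n W orc (Query ''q'') s1 (\<lambda>t' s'. wp n W orc ?rest s' (\<lambda>t''. ?post (t + (t' + t''))))"
      using wW by (simp del: wp_Cond)
  qed
  then show ?thesis unfolding identify_def .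
qed

end

section \<open>One propagation step on one side\<close>

text \<open>The value \<open>b = 1\<close> is tried only if \<open>b = 0\<close> produced two free
  variables, so the final \<open>cnt\<close> and \<open>b\<close> belong together. An implied
  variable takes the value opposite to \<open>b\<close>, whose code is \<open>2 - b\<close>.\<close>

definition step :: com where
  "step = Cond (Equal (Read ''dead'' (Var ''s'')) (Num 0))
     (Seq (Assign ''b'' (Num 0)) (Seq identify
     (Seq (Cond (BAnd not_done (Less (Num 1) (Var ''cnt''))) (Seq (Assign ''b'' (Num 1)) identify) Skip)
       (Cond not_done
         (Cond (Equal (Var ''cnt'') (Num 0)) (Store ''dead'' (Var ''s'') (Num 1))
         (Cond (Equal (Var ''cnt'') (Num 1))
           (Store ''a'' (Plus (Times (Var ''s'') (Var ''n'')) (Var ''t'')) (Minus (Num 2) (Var ''b'')))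
           (Assign ''fin'' (Num 1))))
         Skip))))
     Skip"

text \<open>The blocks of different sides do not overlap: dividing an index by \<open>n\<close>
  recovers the side.\<close>

lemma side_upd:
  assumes "array s ''a'' = (array s0 ''a'')(\<sigma> * n + t := c)" "t < n"
  shows "side n s \<sigma> = (side n s0 \<sigma>)(t := c)" "\<sigma>' \<noteq> \<sigma> \<Longrightarrow> side n s \<sigma>' = side n s0 \<sigma>'"
proof -
  have idx: "\<sigma>' * n + i = \<sigma> * n + t \<longleftrightarrow> \<sigma>' = \<sigma> \<and> i = t" if "i < n" for i \<sigma>'
  proof
    assume eq: "\<sigma>' * n + i = \<sigma> * n + t"
    have "\<sigma>' = (\<sigma>' * n + i) div n" "\<sigma> = (\<sigma> * n + t) div n" using that assms(2) by simp_all
    then have "\<sigma>' = \<sigma>" using eq by simp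
    then show "\<sigma>' = \<sigma> \<and> i = t" using eq by simp
  qed simp
  show "side n s \<sigma> = (side n s0 \<sigma>)(t := c)"
    using assms idx by (auto simp: side_def fun_eq_iff)
  show "side n s \<sigma>' = side n s0 \<sigma>'" if "\<sigma>' \<noteq> \<sigma>"
    using assms idx that by (auto simp: side_def fun_eq_iff)
qed

lemma side_cong: "array s ''a'' = array s' ''a'' \<Longrightarrow> side n s = side n s'"
  by (simp add: side_def fun_eq_iff)

context hidden_2sat
begin

abbreviation step_scalars :: "vname set" where
  "step_scalars \<equiv> ident_scalars \<union> {''b'', ''fin''}"

definition step_outcome :: "state \<Rightarrow> state \<Rightarrow> bool" where
  "step_outcome s0 s \<longleftrightarrow>
     (array s ''a'' = array s0 ''a'' \<and> array s ''dead'' = (array s0 ''dead'')(scalar s0 ''s'' := 1) \<and>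
       scalar s ''fin'' = scalar s0 ''fin'' \<and> (\<forall>w. extends n w (cur s0) \<longrightarrow> \<not> satisfies w \<Phi>)) \<or>
     (array s ''dead'' = array s0 ''dead'' \<and> scalar s ''fin'' = scalar s0 ''fin'' \<and>
       (\<exists>t c. t < n \<and> cur s0 t = 0 \<and> c \<in> {1, 2} \<and>
         array s ''a'' = (array s0 ''a'')(scalar s0 ''s'' * n + t := c) \<and>
         (\<forall>w. extends n w (cur s0) \<and> satisfies w \<Phi> \<longrightarrow> w t = (c = 2)))) \<or>
     (array s ''a'' = array s0 ''a'' \<and> array s ''dead'' = array s0 ''dead'' \<and> scalar s ''fin'' = 1 \<and>
       closed_under \<Phi> (cur s0))"

lemma wp_step:
  assumes n: "scalar s0 ''n'' = n" "scalar s0 ''s'' \<le> 1" "scalar s0 ''done'' = 0"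
    and codes: "\<And>i. cur s0 i \<le> 2" and live: "array s0 ''dead'' (scalar s0 ''s'') = 0"
  shows "wp n W orc step s0 (\<lambda>t s. t \<le> 62 * n + 60 \<and> frame step_scalars {''out'', ''a'', ''dead''} s0 s \<and>
    (solved s \<or> scalar s ''done'' = 0 \<and> step_outcome s0 s))"
proof -
  let ?A = "cur s0"
  let ?X = "ident_scalars \<union> {''b''}"
  \<comment> \<open>Closure is recorded already at this point, because the evidence for
    \<open>b = 0\<close> is no longer in the state once the second identification has overwritten
    \<open>cnt\<close>. If there is no second one, \<open>cnt\<close> is below 2 and the clause is
    vacuous.\<close>
  let ?mid = "\<lambda>s. frame ?X {''out''} s0 s \<and> (solved s \<or> scalar s ''done'' = 0 \<and> scalar s ''b'' \<le> 1 \<and>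
    identified ?A (scalar s ''b'') (scalar s ''cnt'') (scalar s ''t'') \<and>
    (2 \<le> scalar s ''cnt'' \<longrightarrow> closed_under \<Phi> ?A))"
  let ?second = "Cond (BAnd not_done (Less (Num 1) (Var ''cnt''))) (Seq (Assign ''b'' (Num 1)) identify) Skip"
  let ?last = "Cond not_done
         (Cond (Equal (Var ''cnt'') (Num 0)) (Store ''dead'' (Var ''s'') (Num 1))
         (Cond (Equal (Var ''cnt'') (Num 1))
           (Store ''a'' (Plus (Times (Var ''s'') (Var ''n'')) (Var ''t'')) (Minus (Num 2) (Var ''b'')))
           (Assign ''fin'' (Num 1))))
         Skip"
  have W: "0 < W" "Suc 0 < W" "2 < W" using base_less_W(3) by simp_all
  have ident: "wp n W orc identify (s\<lparr>scalar := (scalar s)(''b'' := b)\<rparr>)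
      (\<lambda>t s'. t \<le> 31 * n + 20 \<and> frame ?X {''out''} s0 s' \<and> (solved s' \<or> scalar s' ''done'' = 0 \<and>
        scalar s' ''b'' = b \<and> identified ?A b (scalar s' ''cnt'') (scalar s' ''t'')))"
    if f: "frame ?X {''out''} s0 s" and d: "scalar s ''done'' = 0" and b: "b \<le> 1" for s b
  proof -
    let ?s = "s\<lparr>scalar := (scalar s)(''b'' := b)\<rparr>"
    have f1: "frame ?X {''out''} s0 ?s" by (rule frame_scalar_upd[OF _ f]) simp
    have cur1: "cur ?s = ?A" by (rule frame_cur[OF f1]) simp_all
    have "scalar ?s ''n'' = n" "scalar ?s ''s'' \<le> 1"
      using frame_scalar[OF f1, of "''n''"] frame_scalar[OF f1, of "''s''"] n by simp_all
    then have "ready ?s" unfolding ready_def cur1 using d b codes by simp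
    from wp_identify[OF this] show ?thesis
    proof (rule wp_mono)
      fix t s' assume s': "t \<le> 31 * n + 20 \<and> frame ident_scalars {''out''} ?s s' \<and> (solved s' \<or>
        scalar s' ''done'' = 0 \<and> identified (cur ?s) (scalar ?s ''b'') (scalar s' ''cnt'') (scalar s' ''t''))"
      then have f': "frame ident_scalars {''out''} ?s s'" by blast
      have "frame ?X {''out''} s0 s'" by (rule frame_trans[OF f1 frame_mono[OF f']]) auto
      moreover have "scalar s' ''b'' = b" using frame_scalar[OF f', of "''b''"] by simp
      ultimately show "t \<le> 31 * n + 20 \<and> frame ?X {''out''} s0 s' \<and> (solved s' \<or> scalar s' ''done'' = 0 \<and>
        scalar s' ''b'' = b \<and> identified ?A b (scalar s' ''cnt'') (scalar s' ''t''))"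
        using s' unfolding cur1 by simp
    qed
  qed
  have last: "wp n W orc ?last s (\<lambda>t s'. t \<le> 4 \<and> frame step_scalars {''out'', ''a'', ''dead''} s0 s' \<and>
      (solved s' \<or> scalar s' ''done'' = 0 \<and> step_outcome s0 s'))" if mid: "?mid s" for s
  proof -
    have f: "frame ?X {''out''} s0 s" using mid by blast
    have f': "frame step_scalars {''out'', ''a'', ''dead''} s0 s" by (rule frame_mono[OF f]) auto
    have eqs: "scalar s ''n'' = n" "scalar s ''s'' = scalar s0 ''s''" "scalar s ''fin'' = scalar s0 ''fin''"
      "array s ''a'' = array s0 ''a''" "array s ''dead'' = array s0 ''dead''"
      using f n by (simp_all add: frame_def)
    show ?thesis
    proof (cases "solved s")
      case True
      then show ?thesis using f' by (simp add: not_done_def solved_def)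
    next
      case False
      then have m: "scalar s ''done'' = 0" "scalar s ''b'' \<le> 1"
        "identified ?A (scalar s ''b'') (scalar s ''cnt'') (scalar s ''t'')"
        "2 \<le> scalar s ''cnt'' \<Longrightarrow> closed_under \<Phi> ?A" using mid by auto
      have sW: "scalar s0 ''s'' < W" using n(2) W by simp
      consider "scalar s ''cnt'' = 0" | "scalar s ''cnt'' = 1" | "2 \<le> scalar s ''cnt''" by linarith
      then show ?thesis
      proof cases
        case 1
        have dead: "\<forall>w. extends n w ?A \<longrightarrow> \<not> satisfies w \<Phi>" using m(3) 1 by (auto simp: identified_def)
        let ?s = "s\<lparr>array := (array s)(''dead'' := (array s0 ''dead'')(scalar s0 ''s'' := Suc 0))\<rparr>"
        have "step_outcome s0 ?s" unfolding step_outcome_def using dead eqs by simp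
        moreover have "frame step_scalars {''out'', ''a'', ''dead''} s0 ?s" using f' by (simp add: frame_def)
        ultimately show ?thesis using 1 m(1) eqs W sW by (simp add: not_done_def)
      next
        case 2
        have t: "scalar s ''t'' < n" "?A (scalar s ''t'') = 0"
          "\<And>w. extends n w ?A \<Longrightarrow> satisfies w \<Phi> \<Longrightarrow> w (scalar s ''t'') = (scalar s ''b'' = 0)"
          using m(3) 2 by (auto simp: identified_def)
        let ?c = "2 - scalar s ''b''"
        have c: "?c \<in> {1, 2}" "?c = 2 \<longleftrightarrow> scalar s ''b'' = 0" using m(2) by auto
        let ?s = "s\<lparr>array := (array s)(''a'' := (array s0 ''a'')(scalar s0 ''s'' * n + scalar s ''t'' := ?c))\<rparr>"
        have "step_outcome s0 ?s" unfolding step_outcome_def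
          by (intro disjI2 disjI1 conjI exI[of _ "scalar s ''t''"] exI[of _ ?c]) (use t c eqs in auto)
        moreover have "frame step_scalars {''out'', ''a'', ''dead''} s0 ?s" using f' by (simp add: frame_def)
        moreover have "scalar s0 ''s'' * n + scalar s ''t'' < W"
        proof -
          have "scalar s0 ''s'' * n \<le> 1 * n" using n(2) by (intro mult_right_mono) auto
          then show ?thesis using t(1) base_less_W(2) by linarith
        qed
        moreover have "?c < W" using W by linarith
        ultimately show ?thesis using 2 m(1) eqs by (simp add: not_done_def)
      next
        case 3
        let ?s = "s\<lparr>scalar := (scalar s)(''fin'' := Suc 0)\<rparr>"
        have "step_outcome s0 ?s" unfolding step_outcome_def using m(4)[OF 3] eqs by simp
        moreover have "frame step_scalars {''out'', ''a'', ''dead''} s0 ?s" using f' by (simp add: frame_def)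
        ultimately show ?thesis using 3 m(1) W by (simp add: not_done_def)
      qed
    qed
  qed
  have second: "wp n W orc ?second s (\<lambda>t s'. t \<le> 31 * n + 22 \<and> ?mid s')"
    if f: "frame ?X {''out''} s0 s" and s: "solved s \<or> scalar s ''done'' = 0 \<and> scalar s ''b'' = 0 \<and>
      identified ?A 0 (scalar s ''cnt'') (scalar s ''t'')" for s
  proof (cases "scalar s ''done'' = 0 \<and> 1 < scalar s ''cnt''")
    case False
    then show ?thesis using f s by (auto simp: not_done_def solved_def)
  next
    case True
    then have id0: "identified ?A 0 (scalar s ''cnt'') (scalar s ''t'')" using s by (simp add: solved_def)
    have "wp n W orc identify (s\<lparr>scalar := (scalar s)(''b'' := 1)\<rparr>) (\<lambda>t s'. Suc (1 + t) \<le> 31 * n + 22 \<and> ?mid s')"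
    proof (rule wp_mono[OF ident[OF f]])
      fix t s' assume s': "t \<le> 31 * n + 20 \<and> frame ?X {''out''} s0 s' \<and> (solved s' \<or> scalar s' ''done'' = 0 \<and>
        scalar s' ''b'' = 1 \<and> identified ?A 1 (scalar s' ''cnt'') (scalar s' ''t''))"
      \<comment> \<open>The completion by 0 is covered by \<open>id0\<close> from the first
        identification, the completion by 1 by the second.\<close>
      have "closed_under \<Phi> ?A" if "identified ?A 1 (scalar s' ''cnt'') (scalar s' ''t'')" "2 \<le> scalar s' ''cnt''"
      proof (rule closed_under_if_completions[OF two_sat_formula codes])
        fix b :: nat and C l
        assume "b \<in> {0, 1}" and C: "C \<in> set \<Phi>" "\<not> clause_true (filled ?A b) C" "l \<in> C"
        then consider "b = 0" | "b = 1" by blast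
        then show "?A (var l) = 0"
          using C that id0 True unfolding identified_def by cases (simp_all add: Suc_le_eq numeral_2_eq_2)
      qed
      then show "Suc (1 + t) \<le> 31 * n + 22 \<and> ?mid s'" using s' by auto
    qed (use True in simp_all)
    then show ?thesis using True W by (simp add: not_done_def)
  qed
  have "wp n W orc identify (s0\<lparr>scalar := (scalar s0)(''b'' := 0)\<rparr>)
      (\<lambda>t s. wp n W orc ?second s (\<lambda>t' s'. wp n W orc ?last s' (\<lambda>t'' s''. Suc (1 + (t + (t' + t''))) \<le> 62 * n + 60 \<and>
        frame step_scalars {''out'', ''a'', ''dead''} s0 s'' \<and>
        (solved s'' \<or> scalar s'' ''done'' = 0 \<and> step_outcome s0 s''))))"
  proof (rule wp_mono[OF ident[OF frame_refl n(3)]])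
    fix t s assume s: "t \<le> 31 * n + 20 \<and> frame ?X {''out''} s0 s \<and> (solved s \<or> scalar s ''done'' = 0 \<and>
        scalar s ''b'' = 0 \<and> identified ?A 0 (scalar s ''cnt'') (scalar s ''t''))"
    show "wp n W orc ?second s (\<lambda>t' s'. wp n W orc ?last s' (\<lambda>t'' s''. Suc (1 + (t + (t' + t''))) \<le> 62 * n + 60 \<and>
        frame step_scalars {''out'', ''a'', ''dead''} s0 s'' \<and>
        (solved s'' \<or> scalar s'' ''done'' = 0 \<and> step_outcome s0 s'')))"
    proof (rule wp_mono[OF second])
      fix t' s' assume s': "t' \<le> 31 * n + 22 \<and> ?mid s'"
      then have "?mid s'" by blast
      from last[OF this] show "wp n W orc ?last s' (\<lambda>t'' s''. Suc (1 + (t + (t' + t''))) \<le> 62 * n + 60 \<and>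
        frame step_scalars {''out'', ''a'', ''dead''} s0 s'' \<and>
        (solved s'' \<or> scalar s'' ''done'' = 0 \<and> step_outcome s0 s''))"
        by (rule wp_mono) (use s s' in simp)
    qed (use s in blast)+
  qed simp
  then show ?thesis unfolding step_def wp_Cond[of _ _ _ "Equal (Read ''dead'' (Var ''s'')) (Num 0)"] wp_Seq[of _ _ _ "Assign ''b'' (Num 0)"]
      wp_Seq[of _ _ _ identify] wp_Seq[of _ _ _ ?second] wp_Assign
    using live W by (simp del: wp_Cond wp_Seq)
qed

end

section \<open>Lockstep propagation, commitment and amortised running time\<close>

definition propagate :: com where
  "propagate = While (BAnd not_done (Equal (Var ''fin'') (Num 0)))
     (Seq (Assign ''s'' (Num 0)) (Seq step
       (Cond (BAnd not_done (Equal (Var ''fin'') (Num 0))) (Seq (Assign ''s'' (Num 1)) step) Skip)))"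

text \<open>The successful side replaces the other one, so that the next branching again starts from
  two equal blocks.\<close>

definition commit :: com where
  "commit = for_loop (Store ''a'' (Plus (Times (Minus (Num 1) (Var ''s'')) (Var ''n'')) (Var ''i''))
     (Read ''a'' (Plus (Times (Var ''s'') (Var ''n'')) (Var ''i''))))"

definition branch :: com where
  "branch = Seq (Store ''a'' (Var ''x'') (Num 1)) (Seq (Store ''a'' (Plus (Var ''n'') (Var ''x'')) (Num 2))
     (Seq (Store ''dead'' (Num 0) (Num 0)) (Seq (Store ''dead'' (Num 1) (Num 0))
     (Seq (Assign ''fin'' (Num 0)) (Seq propagate (Cond not_done commit Skip))))))"

definition solver :: com where
  "solver = Seq
     (While (BAnd not_done (Less (Var ''x'') (Var ''n'')))
       (Cond (Equal (Read ''a'' (Var ''x'')) (Num 0)) branch (Assign ''x'' (Plus (Var ''x'') (Num 1)))))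
     (Cond not_done (for_loop (Store ''out'' (Var ''i'') (Minus (Read ''a'' (Var ''i'')) (Num 1)))) Skip)"

context hidden_2sat
begin

text \<open>The invariant of side \<open>\<sigma>\<close>: it extends \<open>S\<close> by setting variable \<open>x\<close> to \<open>\<sigma>\<close> and by consequences
  of that choice, or it is dead and the choice is impossible.\<close>

definition side_inv :: "(nat \<Rightarrow> nat) \<Rightarrow> nat \<Rightarrow> nat \<Rightarrow> state \<Rightarrow> bool" where
  "side_inv S x \<sigma> s \<longleftrightarrow> (\<forall>i. side n s \<sigma> i \<le> 2) \<and> (\<forall>i. S i \<noteq> 0 \<longrightarrow> side n s \<sigma> i = S i) \<and> side n s \<sigma> x \<noteq> 0 \<and>
     (\<forall>w. satisfies w \<Phi> \<and> extends n w S \<and> w x = (\<sigma> = 1) \<longrightarrow>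
       array s ''dead'' \<sigma> = 0 \<and> extends n w (side n s \<sigma>))"

text \<open>The last disjunct: unless \<open>\<sigma>\<close> is dead, one more variable of it has been set.\<close>

definition step_result :: "(nat \<Rightarrow> nat) \<Rightarrow> nat \<Rightarrow> nat \<Rightarrow> state \<Rightarrow> state \<Rightarrow> bool" where
  "step_result S x \<sigma> s0 s \<longleftrightarrow>
     side n s (1 - \<sigma>) = side n s0 (1 - \<sigma>) \<and> array s ''dead'' (1 - \<sigma>) = array s0 ''dead'' (1 - \<sigma>) \<and>
     side_inv S x \<sigma> s \<and>
     (scalar s ''fin'' = 1 \<and> array s0 ''dead'' \<sigma> = 0 \<and> side n s \<sigma> = side n s0 \<sigma> \<and> closed_under \<Phi> (side n s \<sigma>) \<or>
      scalar s ''fin'' = 0 \<and> (array s ''dead'' \<sigma> \<noteq> 0 \<or>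
        array s0 ''dead'' \<sigma> = 0 \<and> Suc (free_count n (side n s \<sigma>)) = free_count n (side n s0 \<sigma>)))"

lemma step_result_if_outcome:
  assumes s: "scalar s0 ''s'' = \<sigma>" "\<sigma> \<le> 1" and fin0: "scalar s0 ''fin'' = 0" and live: "array s0 ''dead'' \<sigma> = 0"
    and inv: "side_inv S x \<sigma> s0" and out: "step_outcome s0 s"
  shows "step_result S x \<sigma> s0 s"
proof -
  have ne: "1 - \<sigma> \<noteq> \<sigma>" using s(2) by arith
  have cur: "cur s0 = side n s0 \<sigma>" using s(1) by simp
  from out[unfolded step_outcome_def s(1) fin0] show ?thesis
  proof (elim disjE exE conjE)
    assume dead: "array s ''a'' = array s0 ''a''" "array s ''dead'' = (array s0 ''dead'')(\<sigma> := 1)"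
       "scalar s ''fin'' = 0" "\<forall>w. extends n w (side n s0 \<sigma>) \<longrightarrow> \<not> satisfies w \<Phi>"
    have sd: "side n s \<tau> = side n s0 \<tau>" for \<tau> using side_cong[OF dead(1)] by simp
    have no: "\<not> (satisfies w \<Phi> \<and> extends n w S \<and> w x = (\<sigma> = 1))" for w
      using inv dead(4) unfolding side_inv_def by metis
    have "side_inv S x \<sigma> s" unfolding side_inv_def sd
    proof (intro conjI allI impI)
      fix w assume "satisfies w \<Phi> \<and> extends n w S \<and> w x = (\<sigma> = 1)"
      then show "array s ''dead'' \<sigma> = 0" "extends n w (side n s0 \<sigma>)" by (rule notE[OF no])+
    qed (use inv in \<open>auto simp: side_inv_def\<close>)
    then show ?thesis unfolding step_result_def sd using dead(2,3) ne by simp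
  next
    fix t c
    assume add: "array s ''dead'' = array s0 ''dead''" "scalar s ''fin'' = 0"
       "t < n" "side n s0 \<sigma> t = 0" "c \<in> {1, 2}" "array s ''a'' = (array s0 ''a'')(\<sigma> * n + t := c)"
       "\<forall>w. extends n w (side n s0 \<sigma>) \<and> satisfies w \<Phi> \<longrightarrow> w t = (c = 2)"
    note sd = side_upd[OF add(6,3)]
    have "extends n w ((side n s0 \<sigma>)(t := c))"
      if "extends n w (side n s0 \<sigma>)" "satisfies w \<Phi>" for w
    proof -
      have "w t = (c = 2)" using that add(7) by blast
      then have "w t = (c \<noteq> 1)" using add(5) by auto
      then show ?thesis using that(1) by (simp add: extends_def)
    qed
    moreover have "S t = 0" "x \<noteq> t" using inv add(4) unfolding side_inv_def by metis+
    moreover have "c \<le> 2" "c \<noteq> 0" using add(5) by auto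
    ultimately have "side_inv S x \<sigma> s" using inv unfolding side_inv_def sd(1) add(1) by simp
    moreover have "Suc (free_count n (side n s \<sigma>)) = free_count n (side n s0 \<sigma>)"
      unfolding sd(1) using add(3-5) by (intro free_count_upd) auto
    ultimately show ?thesis unfolding step_result_def using add(1,2) sd(2)[OF ne] live by simp
  next
    assume fin: "array s ''a'' = array s0 ''a''" "array s ''dead'' = array s0 ''dead''" "scalar s ''fin'' = 1"
       "closed_under \<Phi> (side n s0 \<sigma>)"
    have sd: "side n s \<tau> = side n s0 \<tau>" for \<tau> using side_cong[OF fin(1)] by simp
    have "side_inv S x \<sigma> s" using inv unfolding side_inv_def sd fin(2) .
    then show ?thesis unfolding step_result_def sd using fin(2-4) live by simp
  qed
qed

lemma wp_step_side:
  assumes n: "scalar s0 ''n'' = n" "scalar s0 ''s'' = \<sigma>" "\<sigma> \<le> 1" "scalar s0 ''done'' = 0" "scalar s0 ''fin'' = 0"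
    and inv: "side_inv S x \<sigma> s0"
  shows "wp n W orc step s0 (\<lambda>t s. t \<le> 62 * n + 60 \<and> frame step_scalars {''out'', ''a'', ''dead''} s0 s \<and>
    (solved s \<or> scalar s ''done'' = 0 \<and> step_result S x \<sigma> s0 s))"
proof (cases "array s0 ''dead'' \<sigma> = 0")
  case True
  have codes: "side n s0 (scalar s0 ''s'') i \<le> 2" for i using inv n(2) by (simp add: side_inv_def)
  show ?thesis
  proof (rule wp_mono[OF wp_step[OF n(1) _ n(4) codes]])
    show "scalar s0 ''s'' \<le> 1" "array s0 ''dead'' (scalar s0 ''s'') = 0" using n True by simp_all
  qed (use step_result_if_outcome[OF n(2,3,5) True inv] in blast)
next
  case False
  \<comment> \<open>A dead side idles, which the disjunct
    \<open>array s ''dead'' \<sigma> \<noteq> 0\<close> permits.\<close>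
  then have "step_result S x \<sigma> s0 s0" using inv n by (simp add: step_result_def)
  then show ?thesis using False n by (simp add: step_def frame_refl)
qed

text \<open>An upper bound for one step on each side, with the loop overhead.\<close>

definition round_time :: nat where
  "round_time = 124 * n + 130"

text \<open>The choice of side is immaterial: during propagation at least one side is live, and two
  live sides have equally many free variables.\<close>

definition live_count :: "state \<Rightarrow> nat" where
  "live_count s = (if array s ''dead'' 0 = 0 then free_count n (side n s 0) else free_count n (side n s 1))"

text \<open>At the end the potential keeps one \<open>round_time\<close> for each variable still
  free on the finished side, so propagation is charged only for variables that it sets. The
  \<open>Suc\<close> pays for the last round, in which closure is found and nothing is set.\<close>

definition propagate_pot :: "state \<Rightarrow> nat" where
  "propagate_pot s = (if scalar s ''done'' \<noteq> 0 then 0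
     else if scalar s ''fin'' \<noteq> 0 then round_time * free_count n (cur s)
     else round_time * Suc (live_count s))"

definition propagate_inv :: "(nat \<Rightarrow> nat) \<Rightarrow> nat \<Rightarrow> state \<Rightarrow> bool" where
  "propagate_inv S x s \<longleftrightarrow> scalar s ''n'' = n \<and> scalar s ''x'' = x \<and> (solved s \<or> scalar s ''done'' = 0 \<and>
     (scalar s ''fin'' = 1 \<and> scalar s ''s'' \<le> 1 \<and> side_inv S x (scalar s ''s'') s \<and> closed_under \<Phi> (cur s) \<or>
      scalar s ''fin'' = 0 \<and> side_inv S x 0 s \<and> side_inv S x 1 s \<and>
       (array s ''dead'' 0 = 0 \<and> array s ''dead'' 1 = 0 \<longrightarrow> free_count n (side n s 0) = free_count n (side n s 1))))"

text \<open>Since \<open>S\<close> is closed, some satisfying assignment extends it, and the side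
  that agrees with it on \<open>x\<close> cannot have died. So a round always makes progress on at
  least one side.\<close>

lemma some_side_live:
  assumes "closed_under \<Phi> S" "side_inv S x 0 s" "side_inv S x 1 s"
  shows "array s ''dead'' 0 = 0 \<or> array s ''dead'' 1 = 0"
proof -
  obtain w where "satisfies w \<Phi>" "extends n w S"
    using closed_under_extendable[OF assms(1) sat, of n] by blast
  then show ?thesis using assms(2,3) unfolding side_inv_def by (cases "w x") auto
qed

lemma wp_propagate:
  assumes S: "closed_under \<Phi> S" and inv0: "propagate_inv S x s0"
  shows "wp n W orc propagate s0 (\<lambda>t s. t + propagate_pot s \<le> propagate_pot s0 + 1 \<and>
    scalar s ''n'' = n \<and> scalar s ''x'' = x \<and>
    (solved s \<or> scalar s ''done'' = 0 \<and> scalar s ''fin'' = 1 \<and> scalar s ''s'' \<le> 1 \<and>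
      side_inv S x (scalar s ''s'') s \<and> closed_under \<Phi> (cur s)))"
  unfolding propagate_def
proof (rule wp_mono[OF wp_While[where I = "propagate_inv S x" and pot = propagate_pot]])
  show "propagate_inv S x s0" by (rule inv0)
next
  fix s assume inv: "propagate_inv S x s" and bv: "bval (BAnd not_done (Equal (Var ''fin'') (Num 0))) s"
  have d: "scalar s ''done'' = 0" "scalar s ''fin'' = 0" using bv by (simp_all add: not_done_def)
  then have i: "scalar s ''n'' = n" "scalar s ''x'' = x" "side_inv S x 0 s" "side_inv S x 1 s"
    "array s ''dead'' 0 = 0 \<Longrightarrow> array s ''dead'' 1 = 0 \<Longrightarrow> free_count n (side n s 0) = free_count n (side n s 1)"
    using inv by (auto simp: propagate_inv_def solved_def)
  have pot: "propagate_pot s = round_time + round_time * live_count s"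
    using d by (simp add: propagate_pot_def)
  have W: "0 < W" "Suc 0 < W" using base_less_W(3) by simp_all
  let ?guard = "BAnd not_done (Equal (Var ''fin'') (Num 0))"
  let ?second = "Cond ?guard (Seq (Assign ''s'' (Num 1)) step) Skip"
  let ?post = "\<lambda>t s'. propagate_inv S x s' \<and> t + 1 + propagate_pot s' \<le> propagate_pot s"
  let ?s0 = "s\<lparr>scalar := (scalar s)(''s'' := 0)\<rparr>"
  have side0: "side n ?s0 = side n s" by (rule side_cong) simp
  have inv0: "side_inv S x 0 ?s0" using i(3) by (simp add: side_inv_def side0)
  have "wp n W orc step ?s0 (\<lambda>t1 s1. wp n W orc ?second s1 (\<lambda>t2. ?post (1 + (t1 + t2))))"
  proof (rule wp_mono[OF wp_step_side[OF _ _ _ _ _ inv0]])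
    fix t1 s1 assume s1: "t1 \<le> 62 * n + 60 \<and> frame step_scalars {''out'', ''a'', ''dead''} ?s0 s1 \<and>
      (solved s1 \<or> scalar s1 ''done'' = 0 \<and> step_result S x 0 ?s0 s1)"
    then have f1: "frame step_scalars {''out'', ''a'', ''dead''} ?s0 s1" by blast
    have e1: "scalar s1 ''n'' = n" "scalar s1 ''x'' = x" "scalar s1 ''s'' = 0"
      using f1 i by (simp_all add: frame_def)
    show "wp n W orc ?second s1 (\<lambda>t2. ?post (1 + (t1 + t2)))"
    proof (cases "solved s1")
      case True
      then show ?thesis using s1 e1 pot
        by (simp add: propagate_inv_def propagate_pot_def solved_def not_done_def round_time_def)
    next
      case False
      then have d1: "scalar s1 ''done'' = 0" and res: "step_result S x 0 ?s0 s1" using s1 by auto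
      have r1: "side n s1 1 = side n s 1" "array s1 ''dead'' 1 = array s ''dead'' 1" "side_inv S x 0 s1"
        using res unfolding step_result_def side0 by simp_all
      have inv1: "side_inv S x 1 s1" using i(4) r1 by (simp add: side_inv_def)
      show ?thesis
      proof (cases "scalar s1 ''fin'' = 0")
        case False
        then have r2: "scalar s1 ''fin'' = 1" "array s ''dead'' 0 = 0" "side n s1 0 = side n s 0"
          "closed_under \<Phi> (side n s1 0)"
          using res unfolding step_result_def side0 by auto
        have "propagate_inv S x s1" using e1 d1 r1 r2 by (simp add: propagate_inv_def)
        moreover have "round_time + propagate_pot s1 \<le> propagate_pot s"
          using e1 d1 r2 pot by (simp add: propagate_pot_def live_count_def)
        ultimately show ?thesis using s1 r2 d1 by (simp add: not_done_def round_time_def)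
      next
        case fin0: True
        then have r2: "array s1 ''dead'' 0 \<noteq> 0 \<or> array s ''dead'' 0 = 0 \<and>
            Suc (free_count n (side n s1 0)) = free_count n (side n s 0)"
          using res unfolding step_result_def side0 by auto
        let ?s1 = "s1\<lparr>scalar := (scalar s1)(''s'' := 1)\<rparr>"
        have side1: "side n ?s1 = side n s1" by (rule side_cong) simp
        have inv1': "side_inv S x 1 ?s1" using inv1 unfolding side_inv_def side1 by simp
        have "wp n W orc step ?s1 (\<lambda>t2. ?post (1 + (t1 + Suc (1 + t2))))"
        proof (rule wp_mono[OF wp_step_side[OF _ _ _ _ _ inv1']])
          fix t2 s2 assume s2: "t2 \<le> 62 * n + 60 \<and> frame step_scalars {''out'', ''a'', ''dead''} ?s1 s2 \<and>
            (solved s2 \<or> scalar s2 ''done'' = 0 \<and> step_result S x 1 ?s1 s2)"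
          then have f2: "frame step_scalars {''out'', ''a'', ''dead''} ?s1 s2" by blast
          have e2: "scalar s2 ''n'' = n" "scalar s2 ''x'' = x" "scalar s2 ''s'' = 1"
            using f2 e1 by (simp_all add: frame_def)
          have "propagate_inv S x s2 \<and> round_time + propagate_pot s2 \<le> propagate_pot s"
          proof (cases "solved s2")
            case True
            then show ?thesis using e2 pot by (simp add: propagate_inv_def propagate_pot_def solved_def)
          next
            case False
            then have d2: "scalar s2 ''done'' = 0" and res2: "step_result S x 1 ?s1 s2" using s2 by auto
            have q: "side n s2 0 = side n s1 0" "array s2 ''dead'' 0 = array s1 ''dead'' 0" "side_inv S x 1 s2"
              using res2 unfolding step_result_def side1 by simp_all
            have inv2: "side_inv S x 0 s2" using r1(3) q by (simp add: side_inv_def)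
            show ?thesis
            proof (cases "scalar s2 ''fin'' = 0")
              case False
              then have q2: "scalar s2 ''fin'' = 1" "array s ''dead'' 1 = 0" "side n s2 1 = side n s 1"
                "closed_under \<Phi> (side n s2 1)"
                using res2 r1 unfolding step_result_def side1 by auto
              have "propagate_inv S x s2" using e2 d2 q q2 by (simp add: propagate_inv_def)
              \<comment> \<open>Side 0 may have moved in this round, but side 1 has not. The counts
                are therefore compared at the start of the round, where live sides agree.\<close>
              moreover have "round_time + propagate_pot s2 \<le> propagate_pot s"
                using e2 d2 q2 i(5) pot by (simp add: propagate_pot_def live_count_def)
              ultimately show ?thesis by blast
            next
              case fin2: True
              then have q2: "array s2 ''dead'' 1 \<noteq> 0 \<or> array s ''dead'' 1 = 0 \<and>
                  Suc (free_count n (side n s2 1)) = free_count n (side n s 1)"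
                using res2 r1 unfolding step_result_def side1 by auto
              have alive: "array s2 ''dead'' 0 = 0 \<or> array s2 ''dead'' 1 = 0"
                by (rule some_side_live[OF S inv2 q(3)])
              \<comment> \<open>A side that survives the round was live before and has set exactly
                one variable, so survivors stay equally long.\<close>
              have c0: "array s ''dead'' 0 = 0 \<and> Suc (free_count n (side n s2 0)) = free_count n (side n s 0)"
                if "array s2 ''dead'' 0 = 0" using r2 that unfolding q(1,2) by blast
              have c1: "array s ''dead'' 1 = 0 \<and> Suc (free_count n (side n s2 1)) = free_count n (side n s 1)"
                if "array s2 ''dead'' 1 = 0" using q2 that by blast
              have counts: "array s2 ''dead'' 0 = 0 \<and> array s2 ''dead'' 1 = 0 \<longrightarrow>
                  free_count n (side n s2 0) = free_count n (side n s2 1)"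
                using c0 c1 i(5) by linarith
              have "propagate_inv S x s2" unfolding propagate_inv_def
                using e2(1,2) d2 q(3) fin2 inv2 counts by blast
              moreover have "Suc (live_count s2) = live_count s"
                using alive c0 c1 i(5) unfolding live_count_def by (cases "array s2 ''dead'' 0 = 0") auto
              then have "round_time + propagate_pot s2 = propagate_pot s"
                using d2 fin2 pot by (simp add: propagate_pot_def flip: \<open>Suc (live_count s2) = live_count s\<close>)
              ultimately show ?thesis by simp
            qed
          qed
          then show "?post (1 + (t1 + Suc (1 + t2))) s2" using s1 s2 by (simp add: round_time_def)
        qed (use e1 d1 fin0 in simp_all)
        then show ?thesis using fin0 d1 W by (simp add: not_done_def)
      qed
    qed
  qed (use d i in simp_all)
  then show "wp n W orc (Seq (Assign ''s'' (Num 0)) (Seq step ?second)) s ?post"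
    using W by (simp del: wp_Cond)
next
  fix t s assume "propagate_inv S x s \<and> \<not> bval (BAnd not_done (Equal (Var ''fin'') (Num 0))) s \<and>
    t + propagate_pot s \<le> propagate_pot s0 + 1"
  then show "t + propagate_pot s \<le> propagate_pot s0 + 1 \<and> scalar s ''n'' = n \<and> scalar s ''x'' = x \<and>
    (solved s \<or> scalar s ''done'' = 0 \<and> scalar s ''fin'' = 1 \<and> scalar s ''s'' \<le> 1 \<and>
      side_inv S x (scalar s ''s'') s \<and> closed_under \<Phi> (cur s))"
    by (auto simp: propagate_inv_def not_done_def)
qed

lemma wp_commit:
  assumes n: "scalar s0 ''n'' = n" "scalar s0 ''s'' \<le> 1" and codes: "\<And>i. cur s0 i \<le> 2"
  shows "wp n W orc commit s0 (\<lambda>t s. t \<le> 3 * n + 2 \<and> frame {''i''} {''a''} s0 s \<and>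
    side n s 0 = cur s0 \<and> side n s 1 = cur s0)"
proof -
  let ?\<sigma> = "scalar s0 ''s''"
  let ?I = "\<lambda>k s. frame {''i''} {''a''} s0 s \<and> side n s ?\<sigma> = cur s0 \<and> (\<forall>l<k. side n s (1 - ?\<sigma>) l = cur s0 l)"
  have W: "n < W" "2 < W" using base_less_W(2,3) by simp_all
  have ne: "?\<sigma> \<noteq> 1 - ?\<sigma>" by arith
  show ?thesis unfolding commit_def
  proof (rule wp_mono[OF wp_for_loop[where I = ?I and B = 1, OF W(1) n(1)]])
    have "side n (s0\<lparr>scalar := (scalar s0)(''i'' := 0)\<rparr>) = side n s0" by (rule side_cong) simp
    then show "?I 0 (s0\<lparr>scalar := (scalar s0)(''i'' := 0)\<rparr>)" by (simp add: frame_def)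
  next
    fix k s assume k: "k < n" "scalar s ''i'' = k" "scalar s ''n'' = n" and I: "?I k s"
    have s: "scalar s ''s'' = ?\<sigma>" using I by (simp add: frame_def)
    have "side n s ?\<sigma> k = cur s0 k" using I by simp
    then have val: "array s ''a'' (?\<sigma> * n + k) = cur s0 k" using k(1) by (simp add: side_def)
    then have val_W: "array s ''a'' (?\<sigma> * n + k) < W" using codes[of k] W(2) by linarith
    have "(1 - ?\<sigma>) * n \<le> 1 * n" by (intro mult_right_mono) auto
    then have idx: "(1 - ?\<sigma>) * n + k < W" using k(1) base_less_W(2) by linarith
    let ?s = "s\<lparr>array := (array s)(''a'' := (array s ''a'')((1 - ?\<sigma>) * n + k := array s ''a'' (?\<sigma> * n + k)))\<rparr>"
    let ?s' = "?s\<lparr>scalar := (scalar ?s)(''i'' := Suc k)\<rparr>"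
    have "array ?s' ''a'' = (array s ''a'')((1 - ?\<sigma>) * n + k := array s ''a'' (?\<sigma> * n + k))" by simp
    note sd = side_upd[OF this k(1)]
    have "?I (Suc k) ?s'"
      using I k val sd(1) sd(2)[OF ne] by (simp add: frame_def less_Suc_eq)
    then show "wp n W orc (Store ''a'' (Plus (Times (Minus (Num 1) (Var ''s'')) (Var ''n'')) (Var ''i''))
     (Read ''a'' (Plus (Times (Var ''s'') (Var ''n'')) (Var ''i'')))) s
      (\<lambda>t s'. t \<le> 1 \<and> scalar s' ''i'' = k \<and> scalar s' ''n'' = n \<and>
        ?I (Suc k) (s'\<lparr>scalar := (scalar s')(''i'' := Suc k)\<rparr>))"
      using k s val_W idx by simp
  next
    fix t s assume I: "t \<le> (1 + 2) * n + 2 \<and> ?I n s \<and> scalar s ''n'' = n"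
    have "side n s (1 - ?\<sigma>) = cur s0" using I by (auto simp: side_def fun_eq_iff)
    moreover have "side n s ?\<sigma> = cur s0" using I by blast
    moreover have "?\<sigma> = 0 \<or> ?\<sigma> = 1" using n(2) by linarith
    ultimately have "side n s 0 = cur s0 \<and> side n s 1 = cur s0" by auto
    then show "t \<le> 3 * n + 2 \<and> frame {''i''} {''a''} s0 s \<and> side n s 0 = cur s0 \<and> side n s 1 = cur s0"
      using I by simp
  qed
qed

definition solver_inv :: "state \<Rightarrow> bool" where
  "solver_inv s \<longleftrightarrow> scalar s ''n'' = n \<and> scalar s ''x'' \<le> n \<and> (solved s \<or> scalar s ''done'' = 0 \<and>
     side n s 1 = side n s 0 \<and> (\<forall>i. side n s 0 i \<le> 2) \<and> closed_under \<Phi> (side n s 0) \<and>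
     (\<forall>i<scalar s ''x''. side n s 0 i \<noteq> 0))"

text \<open>A variable that becomes assigned pays for one round of propagation and, since every
  branch assigns at least one, \<open>3 * n + 30\<close> of it covers the copying and overhead of a
  branch. Each advance of \<open>x\<close> costs 3.\<close>

definition solver_pot :: "state \<Rightarrow> nat" where
  "solver_pot s = (if scalar s ''done'' \<noteq> 0 then 0
     else (round_time + (3 * n + 30)) * free_count n (side n s 0) + 3 * (n - scalar s ''x''))"

lemma wp_branch:
  assumes inv: "solver_inv s0" and x: "scalar s0 ''done'' = 0" "scalar s0 ''x'' < n" "side n s0 0 (scalar s0 ''x'') = 0"
  shows "wp n W orc branch s0 (\<lambda>t s. solver_inv s \<and> t + 2 + solver_pot s \<le> solver_pot s0)"
proof -
  let ?x = "scalar s0 ''x''" and ?S = "side n s0 0"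
  have i: "scalar s0 ''n'' = n" "side n s0 1 = ?S" "\<And>i. ?S i \<le> 2" "closed_under \<Phi> ?S" "\<And>i. i < ?x \<Longrightarrow> ?S i \<noteq> 0"
    using inv x(1) by (auto simp: solver_inv_def solved_def)
  have W: "0 < W" "Suc 0 < W" "2 < W" "?x < W" "n + ?x < W" using base_less_W(2,3) x(2) by simp_all
  let ?s = "s0\<lparr>array := (array s0)(''a'' := (array s0 ''a'')(?x := Suc 0, n + ?x := 2),
    ''dead'' := (array s0 ''dead'')(0 := 0, Suc 0 := 0)), scalar := (scalar s0)(''fin'' := 0)\<rparr>"
  let ?r = "s0\<lparr>array := (array s0)(''a'' := (array s0 ''a'')(?x := Suc 0))\<rparr>"
  have "array ?r ''a'' = (array s0 ''a'')(0 * n + ?x := Suc 0)" by simp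
  note r = side_upd[OF this x(2)]
  have "array ?s ''a'' = (array ?r ''a'')(1 * n + ?x := 2)" by simp
  note s = side_upd[OF this x(2)]
  have side0: "side n ?s 0 = ?S(?x := Suc 0)" using s(2)[of 0] r(1) by simp
  have side1: "side n ?s 1 = ?S(?x := 2)" using s(1) r(2)[of 1] i(2) by simp
  have dead: "array ?s ''dead'' 0 = 0" "array ?s ''dead'' 1 = 0" by simp_all
  have sinv0: "side_inv ?S ?x 0 ?s" unfolding side_inv_def side0 dead using i(3) x(3) by (auto simp: extends_def)
  have sinv1: "side_inv ?S ?x 1 ?s" unfolding side_inv_def side1 dead using i(3) x(3) by (auto simp: extends_def)
  have count0: "Suc (free_count n (side n ?s 0)) = free_count n ?S"
    unfolding side0 using x by (intro free_count_upd) auto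
  have count1: "Suc (free_count n (side n ?s 1)) = free_count n ?S"
    unfolding side1 using x by (intro free_count_upd) auto
  have pinv: "propagate_inv ?S ?x ?s"
    unfolding propagate_inv_def using i(1) x(1) sinv0 sinv1 count0 count1 by simp
  have live0: "live_count ?s = free_count n (side n ?s 0)"
    unfolding live_count_def by (simp only: dead simp_thms if_True)
  \<comment> \<open>Both sides have \<open>x\<close> set already; this one variable cancels the
    \<open>Suc\<close> in the potential.\<close>
  have ppot: "propagate_pot ?s = round_time * free_count n ?S"
    unfolding propagate_pot_def live0 count0 using x(1) by simp
  let ?last = "Cond not_done commit Skip"
  have "wp n W orc propagate ?s (\<lambda>t1 s1. wp n W orc ?last s1
      (\<lambda>t2 s2. solver_inv s2 \<and> 1 + (1 + (1 + (1 + (1 + (t1 + t2))))) + 2 + solver_pot s2 \<le> solver_pot s0))"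
  proof (rule wp_mono[OF wp_propagate[OF i(4) pinv]])
    fix t1 s1 assume "t1 + propagate_pot s1 \<le> propagate_pot ?s + 1 \<and> scalar s1 ''n'' = n \<and> scalar s1 ''x'' = ?x \<and>
      (solved s1 \<or> scalar s1 ''done'' = 0 \<and> scalar s1 ''fin'' = 1 \<and> scalar s1 ''s'' \<le> 1 \<and>
        side_inv ?S ?x (scalar s1 ''s'') s1 \<and> closed_under \<Phi> (cur s1))"
    then have t1: "t1 + propagate_pot s1 \<le> round_time * free_count n ?S + 1"
      and e1: "scalar s1 ''n'' = n" "scalar s1 ''x'' = ?x"
      and s1: "solved s1 \<or> scalar s1 ''done'' = 0 \<and> scalar s1 ''fin'' = 1 \<and> scalar s1 ''s'' \<le> 1 \<and>
        side_inv ?S ?x (scalar s1 ''s'') s1 \<and> closed_under \<Phi> (cur s1)"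
      unfolding ppot by blast+
    have pot0: "solver_pot s0 = (round_time + (3 * n + 30)) * free_count n ?S + 3 * (n - ?x)"
      using x(1) by (simp add: solver_pot_def)
    show "wp n W orc ?last s1 (\<lambda>t2 s2. solver_inv s2 \<and> 1 + (1 + (1 + (1 + (1 + (t1 + t2))))) + 2 + solver_pot s2 \<le> solver_pot s0)"
    proof (cases "solved s1")
      case True
      have "30 \<le> (3 * n + 30) * free_count n ?S" using count0[symmetric] by simp
      then have "t1 + 29 \<le> solver_pot s0" using t1 unfolding pot0 add_mult_distrib by linarith
      then show ?thesis using True e1 x(2)
        by (simp add: not_done_def solved_def solver_inv_def solver_pot_def)
    next
      case False
      then have f1: "scalar s1 ''done'' = 0" "scalar s1 ''fin'' = 1" "scalar s1 ''s'' \<le> 1"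
        "side_inv ?S ?x (scalar s1 ''s'') s1" "closed_under \<Phi> (cur s1)" using s1 by auto
      let ?B = "cur s1"
      have B: "\<And>i. ?B i \<le> 2" "\<And>i. ?S i \<noteq> 0 \<Longrightarrow> ?B i = ?S i" "?B ?x \<noteq> 0"
        using f1(4) unfolding side_inv_def by metis+
      have "{i. i < n \<and> ?B i = 0} \<subset> {i. i < n \<and> ?S i = 0}"
      proof (rule psubsetI)
        show "{i. i < n \<and> ?B i = 0} \<subseteq> {i. i < n \<and> ?S i = 0}"
        proof
          fix i assume "i \<in> {i. i < n \<and> ?B i = 0}"
          then have "i < n" "?B i = 0" by simp_all
          then show "i \<in> {i. i < n \<and> ?S i = 0}" using B(2)[of i] by (cases "?S i = 0") simp_all
        qed
        have "?x \<in> {i. i < n \<and> ?S i = 0}" "?x \<notin> {i. i < n \<and> ?B i = 0}" using x(2,3) B(3) by simp_all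
        then show "{i. i < n \<and> ?B i = 0} \<noteq> {i. i < n \<and> ?S i = 0}" by metis
      qed
      then have less: "free_count n ?B < free_count n ?S"
        unfolding free_count_def by (intro psubset_card_mono) auto
      have "propagate_pot s1 = round_time * free_count n ?B" using f1 by (simp add: propagate_pot_def)
      then have t1': "t1 + round_time * free_count n ?B \<le> round_time * free_count n ?S + 1" using t1 by simp
      obtain d where d: "free_count n ?S = free_count n ?B + Suc d" using less less_iff_Suc_add by auto
      have "(3 * n + 30) * free_count n ?S \<ge> (3 * n + 30) * free_count n ?B + (3 * n + 30)"
        unfolding d by simp
      then have time: "t1 + 3 * n + 29 + ((round_time + (3 * n + 30)) * free_count n ?B + 3 * (n - ?x)) \<le> solver_pot s0"
        using t1' unfolding pot0 add_mult_distrib by linarith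
      have "wp n W orc commit s1 (\<lambda>t2 s2. solver_inv s2 \<and> 1 + (1 + (1 + (1 + (1 + (t1 + Suc t2))))) + 2 + solver_pot s2 \<le> solver_pot s0)"
      proof (rule wp_mono[OF wp_commit[OF e1(1) f1(3) B(1)]])
        fix t2 s2 assume s2: "t2 \<le> 3 * n + 2 \<and> frame {''i''} {''a''} s1 s2 \<and> side n s2 0 = ?B \<and> side n s2 1 = ?B"
        then have e2: "scalar s2 ''n'' = n" "scalar s2 ''x'' = ?x" "scalar s2 ''done'' = 0"
          using e1 f1 by (simp_all add: frame_def)
        have sides: "side n s2 0 = ?B" "side n s2 1 = ?B" using s2 by blast+
        have "?B l \<noteq> 0" if "l < ?x" for l using i(5)[OF that] B(2)[of l] by simp
        then have "solver_inv s2" unfolding solver_inv_def e2 sides using B(1) f1(5) x(2) by simp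
        moreover have "solver_pot s2 = (round_time + (3 * n + 30)) * free_count n ?B + 3 * (n - ?x)"
          unfolding solver_pot_def e2 sides by simp
        ultimately show "solver_inv s2 \<and> 1 + (1 + (1 + (1 + (1 + (t1 + Suc t2))))) + 2 + solver_pot s2 \<le> solver_pot s0"
          using time s2 by linarith
      qed
      then show ?thesis using f1(1) by (simp add: not_done_def)
    qed
  qed
  then show ?thesis unfolding branch_def
      wp_Seq[of _ _ _ "Store ''a'' (Var ''x'') (Num 1)"] wp_Seq[of _ _ _ "Store ''a'' (Plus (Var ''n'') (Var ''x'')) (Num 2)"]
      wp_Seq[of _ _ _ "Store ''dead'' (Num 0) (Num 0)"] wp_Seq[of _ _ _ "Store ''dead'' (Num 1) (Num 0)"]
      wp_Seq[of _ _ _ "Assign ''fin'' (Num 0)"] wp_Seq[of _ _ _ propagate]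
    using W i(1) by (simp del: wp_Cond wp_Seq)
qed

lemma wp_solver:
  "wp n W orc solver (initial_state n) (\<lambda>t s. t \<le> 127 * n ^ 2 + 170 * n + 20 \<and> satisfies (output_assignment s) \<Phi>)"
proof -
  let ?b = "BAnd not_done (Less (Var ''x'') (Var ''n''))"
  let ?c = "Cond (Equal (Read ''a'' (Var ''x'')) (Num 0)) branch (Assign ''x'' (Plus (Var ''x'') (Num 1)))"
  let ?out = "for_loop (Store ''out'' (Var ''i'') (Minus (Read ''a'' (Var ''i'')) (Num 1)))"
  let ?s0 = "initial_state n"
  have W: "n < W" "2 < W" using base_less_W(2,3) by simp_all
  have side0: "side n ?s0 \<sigma> = (\<lambda>_. 0)" for \<sigma> by (simp add: initial_state_def side_def fun_eq_iff)
  have inv0: "solver_inv ?s0" unfolding solver_inv_def side0 by (simp add: initial_state_def closed_under_def)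
  have pot0: "solver_pot ?s0 = (round_time + (3 * n + 30)) * n + 3 * n"
    unfolding solver_pot_def side0 by (simp add: initial_state_def free_count_def)
  have loop: "wp n W orc (While ?b ?c) ?s0 (\<lambda>t s. solver_inv s \<and> \<not> bval ?b s \<and> t + solver_pot s \<le> solver_pot ?s0 + 1)"
  proof (rule wp_While[where I = solver_inv, OF inv0])
    fix s assume inv: "solver_inv s" and b: "bval ?b s"
    have e: "scalar s ''done'' = 0" "scalar s ''n'' = n" "scalar s ''x'' < n"
      using b inv by (simp_all add: not_done_def solver_inv_def)
    let ?x = "scalar s ''x''"
    have cell: "array s ''a'' ?x = side n s 0 ?x" using e(3) by (simp add: side_def)
    show "wp n W orc ?c s (\<lambda>t s'. solver_inv s' \<and> t + 1 + solver_pot s' \<le> solver_pot s)"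
    proof (cases "side n s 0 ?x = 0")
      case True
      have "wp n W orc branch s (\<lambda>t s'. solver_inv s' \<and> Suc t + 1 + solver_pot s' \<le> solver_pot s)"
        by (rule wp_mono[OF wp_branch[OF inv e(1,3) True]]) simp
      then show ?thesis using True cell by simp
    next
      case False
      let ?s = "s\<lparr>scalar := (scalar s)(''x'' := Suc ?x)\<rparr>"
      have side: "side n ?s = side n s" by (rule side_cong) simp
      have "solver_inv ?s"
        using inv e False unfolding solver_inv_def side by (auto simp: solved_def less_Suc_eq)
      moreover have "3 + solver_pot ?s \<le> solver_pot s"
        unfolding solver_pot_def side using e by simp
      ultimately show ?thesis using False cell e W by simp
    qed
  qed
  show ?thesis unfolding solver_def wp_Seq[of _ _ _ "While ?b ?c"]
  proof (rule wp_mono[OF loop])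
    fix t s assume s: "solver_inv s \<and> \<not> bval ?b s \<and> t + solver_pot s \<le> solver_pot ?s0 + 1"
    have n: "scalar s ''n'' = n" using s by (simp add: solver_inv_def)
    \<comment> \<open>\<open>round_time + 3 * n + 30\<close> is \<open>127 * n + 160\<close>, taken
      \<open>n\<close> times, and the advances of \<open>x\<close> add \<open>3 * n\<close>.\<close>
    have "t \<le> 127 * n ^ 2 + 163 * n + 1"
      using s pot0 by (simp add: round_time_def power2_eq_square algebra_simps)
    note t = this
    show "wp n W orc (Cond not_done ?out Skip) s
      (\<lambda>t' s'. t + t' \<le> 127 * n ^ 2 + 170 * n + 20 \<and> satisfies (output_assignment s') \<Phi>)"
    proof (cases "solved s")
      case True
      then show ?thesis using t by (simp add: not_done_def solved_def)
    next
      case False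
      let ?A = "side n s 0"
      have A: "scalar s ''done'' = 0" "\<And>i. ?A i \<le> 2" "closed_under \<Phi> ?A" "\<And>i. i < n \<Longrightarrow> ?A i \<noteq> 0"
        using s False by (auto simp: solver_inv_def not_done_def)
      let ?I = "\<lambda>k s'. array s' ''a'' = array s ''a'' \<and> (\<forall>l<k. array s' ''out'' l = ?A l - 1)"
      have "wp n W orc ?out s (\<lambda>t' s'. t + Suc t' \<le> 127 * n ^ 2 + 170 * n + 20 \<and> satisfies (output_assignment s') \<Phi>)"
      proof (rule wp_mono[OF wp_for_loop[where I = ?I and B = 1, OF W(1) n]])
        fix k and s' :: state assume k: "k < n" "scalar s' ''i'' = k" "scalar s' ''n'' = n" and I: "?I k s'"
        have "array s ''a'' k = ?A k" using k(1) by (simp add: side_def)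
        moreover have "?A k - 1 < W" using A(2)[of k] W(2) by linarith
        ultimately show "wp n W orc (Store ''out'' (Var ''i'') (Minus (Read ''a'' (Var ''i'')) (Num 1))) s'
          (\<lambda>t s'. t \<le> 1 \<and> scalar s' ''i'' = k \<and> scalar s' ''n'' = n \<and>
            ?I (Suc k) (s'\<lparr>scalar := (scalar s')(''i'' := Suc k)\<rparr>))"
          using I k W by (simp add: less_Suc_eq)
      next
        fix t' and s' :: state assume I: "t' \<le> (1 + 2) * n + 2 \<and> ?I n s' \<and> scalar s' ''n'' = n"
        have "satisfies (output_assignment s') \<Phi> = satisfies (\<lambda>i. ?A i \<noteq> 1) \<Phi>"
        proof (rule satisfies_cong)
          fix l assume l: "l < n"
          then have "array s' ''out'' l = ?A l - 1" using I by blast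
          then show "output_assignment s' l = (?A l \<noteq> 1)"
            using A(2)[of l] A(4)[OF l] by (auto simp: output_assignment_def)
        qed
        then have "satisfies (output_assignment s') \<Phi>"
          using satisfies_if_closed_total[OF A(3) sat two_sat_formula A(4)] by simp
        then show "t + Suc t' \<le> 127 * n ^ 2 + 170 * n + 20 \<and> satisfies (output_assignment s') \<Phi>"
          using t I by simp
      qed simp
      then show ?thesis using A(1) by (simp add: not_done_def)
    qed
  qed
qed

end

theorem theorem4:
  shows "\<exists>(P :: com) (d :: nat) (T :: nat \<Rightarrow> nat).
    (\<lambda>n. real (T n)) \<in> O(\<lambda>n. real n ^ 2) \<and>
    (\<forall>n \<Phi> orc.
       two_sat n \<Phi> \<and> repetition_free \<Phi> \<and> satisfiable \<Phi> \<and> worst_violated_oracle n \<Phi> orc \<longrightarrow>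
       (\<exists>t s. exec n ((n + 2) ^ d) orc P (initial_state n) t s \<and>
          t \<le> T n \<and> satisfies (output_assignment s) \<Phi>))"
proof (rule exI[of _ solver], rule exI[of _ 7], rule exI[of _ "\<lambda>n. 127 * n ^ 2 + 170 * n + 20"],
    intro conjI allI impI)
  let ?T = "\<lambda>n :: nat. 127 * n ^ 2 + 170 * n + 20"
  show "(\<lambda>n. real (?T n)) \<in> O(\<lambda>n. real n ^ 2)"
  \<comment> \<open>The sum 127 + 170 + 20, valid from \<open>n = 1\<close> on.\<close>
  proof (rule bigoI[where c = 317])
    show "\<forall>\<^sub>F n in sequentially. norm (real (?T n)) \<le> 317 * norm (real n ^ 2)"
      using eventually_ge_at_top[of "1 :: nat"]
    proof eventually_elim
      case (elim n)
      then have "n \<le> n ^ 2" "1 \<le> n ^ 2" by (simp_all add: power2_eq_square)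
      then have "?T n \<le> 317 * n ^ 2" by linarith
      then have "real (?T n) \<le> real (317 * n ^ 2)" by (simp only: of_nat_le_iff)
      then show ?case by simp
    qed
  qed
  fix n \<Phi> orc
  assume *: "two_sat n \<Phi> \<and> repetition_free \<Phi> \<and> satisfiable \<Phi> \<and> worst_violated_oracle n \<Phi> orc"
  interpret hidden_2sat n \<Phi> orc using * by unfold_locales simp_all
  show "\<exists>t s. exec n ((n + 2) ^ 7) orc solver (initial_state n) t s \<and> t \<le> ?T n \<and> satisfies (output_assignment s) \<Phi>"
    using wp_solver unfolding wp_def W_def by blast
qed

end
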